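(* Every perfect code $Z\subset\{0,1\}^n$ is discrepancy-minimizing, i.e. $D^{L_2}(Z)\le D^{L_2}(Z')$ for every $Z'\subset\{0,1\}^n$ with $|Z'|=|Z|$.
   Context: $d$ is the Hamming distance, $B(x,t)=\{y:d(x,y)\le t\}$. A code $Z\subset\{0,1\}^n$ is perfect if there is an integer $e\ge0$ such that every $x\in\{0,1\}^n$ is at distance at most $e$ from exactly one element of $Z$. For $Z=\{z_1,\dots,z_N\}$, $D^{L_2}(Z)=\sum_{t=0}^n\sum_{x\in\{0,1\}^n}\Big(\frac1N\sum_{j=1}^N\mathbb 1_{B(x,t)}(z_j)-\frac{|B(x,t)|}{2^n}\Big)^2$. *)

theory Defs
  imports Complex_Main "HOL-Library.FuncSet" "HOL-Library.Indicator_Function"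
begin

text \<open>Words in \<open>{0,1}\<^sup>n\<close> are extensional functions on the coordinate set \<open>{..<n}\<close>.\<close>

definition cube :: "nat \<Rightarrow> (nat \<Rightarrow> nat) set" where
  "cube n = {..<n} \<rightarrow>\<^sub>E {0, 1}"

definition hamming :: "nat \<Rightarrow> (nat \<Rightarrow> nat) \<Rightarrow> (nat \<Rightarrow> nat) \<Rightarrow> nat" where
  "hamming n x y = card {i \<in> {..<n}. x i \<noteq> y i}"

definition hball :: "nat \<Rightarrow> (nat \<Rightarrow> nat) \<Rightarrow> nat \<Rightarrow> (nat \<Rightarrow> nat) set" where
  "hball n x t = {y \<in> cube n. hamming n x y \<le> t}"

definition perfect_code :: "nat \<Rightarrow> (nat \<Rightarrow> nat) set \<Rightarrow> bool" where
  "perfect_code n Z \<longleftrightarrow>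
     Z \<subseteq> cube n \<and> (\<exists>e::nat. \<forall>x \<in> cube n. \<exists>!z. z \<in> Z \<and> hamming n x z \<le> e)"

definition discrepancy :: "nat \<Rightarrow> (nat \<Rightarrow> nat) set \<Rightarrow> real" where
  "discrepancy n Z =
     (\<Sum>t = 0..n. \<Sum>x \<in> cube n.
        (1 / real (card Z) * (\<Sum>z \<in> Z. indicator (hball n x t) z)
         - real (card (hball n x t)) / 2 ^ n)\<^sup>2)"

definition discrepancy_minimizing :: "nat \<Rightarrow> (nat \<Rightarrow> nat) set \<Rightarrow> bool" where
  "discrepancy_minimizing n Z \<longleftrightarrow>
     (\<forall>Z'. Z' \<subseteq> cube n \<and> card Z' = card Z \<longrightarrow> discrepancy n Z \<le> discrepancy n Z')"

end

theory Submission
  imports Defs "HOL-Computational_Algebra.Polynomial"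
begin

text \<open>
  Words are identified with subsets of \<open>{..<n}\<close>. Let \<open>Zh(u) = \<Sum>z\<in>Z. chi u z\<close> be the Fourier
  transform of the code and \<open>L\<^sub>t(u)\<close> that of the ball of radius \<open>t\<close>. By Parseval the discrepancy
  is, up to a constant, the sum over \<open>u \<noteq> 0\<close> of \<open>Zh(u)\<^sup>2 \<Sum>t. L\<^sub>t(u)\<^sup>2\<close>. With \<open>k = |u|\<close>, the numbers
  \<open>L\<^sub>t(u)\<close> are the coefficients of \<open>(1 - z)^(k - 1) (1 + z)^(n - k)\<close>; Parseval over roots
  of \<open>-1\<close> writes \<open>\<Sum>t. L\<^sub>t(u)\<^sup>2\<close> as a positive combination of functions \<open>\<rho>^k + \<rho>^(n + 1 - k)\<close>, hence of
  functions \<open>k^m + (n + 1 - k)^m\<close>, and it suffices to treat the latter.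

  This is a linear programming bound. If \<open>Z\<close> is \<open>e\<close>-perfect, then \<open>Zh L\<^sub>e\<close> vanishes off \<open>0\<close>, the
  nodes \<open>t = n + 1 - |u|\<close> with \<open>Zh(u) \<noteq> 0\<close>, \<open>u \<noteq> 0\<close> are exactly the \<open>e\<close> roots of the Lloyd
  polynomial \<open>L\<^sub>e\<close>, and the \<open>L\<^sub>j\<close> with \<open>j \<le> e\<close> are orthogonal for the weight \<open>Zh(u)\<^sup>2 |u|\<close> on the nodes.
  Interpolating \<open>t^m\<close> twice at the nodes gives \<open>t^m = A + L\<^sub>e C + L\<^sub>e\<^sup>2 g\<close>, where \<open>A\<close> and \<open>C\<close> are
  nonnegative combinations of the \<open>L\<^sub>j\<close> with \<open>j < e\<close> and \<open>g \<ge> 0\<close>. After symmetrising under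
  \<open>t \<mapsto> n + 1 - t\<close>, the part \<open>A + L\<^sub>e C\<close> is a positive definite minorant whose transform is supported on
  weights below \<open>2 e\<close>. It is tight for \<open>Z\<close>, because \<open>Z\<close> has minimum distance above \<open>2 e\<close>.
\<close>

section \<open>Fourier analysis on the binary cube\<close>

text \<open>Addition in the group of binary words, with words as subsets;
  \<open>card (sdiff u v)\<close> is the Hamming distance.\<close>

definition sdiff :: "'a set \<Rightarrow> 'a set \<Rightarrow> 'a set" where
  "sdiff u v = {i. (i \<in> u) \<noteq> (i \<in> v)}"

lemma sdiff_simps [simp]:
  "sdiff u u = {}" "sdiff u {} = u" "sdiff {} u = u" "sdiff u (sdiff u v) = v"
  by (auto simp: sdiff_def)

lemma sdiff_commute: "sdiff u v = sdiff v u"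
  by (auto simp: sdiff_def)

lemma sdiff_eq_empty_iff [simp]: "sdiff u v = {} \<longleftrightarrow> u = v"
  by (auto simp: sdiff_def)

lemma sdiff_subset: "u \<subseteq> A \<Longrightarrow> v \<subseteq> A \<Longrightarrow> sdiff u v \<subseteq> A"
  by (auto simp: sdiff_def)

lemma finite_sdiff: "finite u \<Longrightarrow> finite v \<Longrightarrow> finite (sdiff u v)"
  by (rule finite_subset[of _ "u \<union> v"]) (auto simp: sdiff_def)

lemma card_sdiff_le: "finite u \<Longrightarrow> finite v \<Longrightarrow> card (sdiff u v) \<le> card u + card v"
  by (rule order_trans[OF card_mono[of "u \<union> v"] card_Un_le]) (auto simp: sdiff_def)

lemma bij_betw_sdiff: "u \<subseteq> A \<Longrightarrow> bij_betw (sdiff u) (Pow A) (Pow A)"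
  by (rule bij_betw_byWitness[where f' = "sdiff u"]) (auto simp: sdiff_def)

lemma sum_Pow_sdiff:
  assumes "u \<subseteq> A" shows "(\<Sum>v\<in>Pow A. f (sdiff u v)) = (\<Sum>v\<in>Pow A. f v)"
  by (rule sum.reindex_bij_betw[OF bij_betw_sdiff[OF assms]])

text \<open>The characters of the group of words under \<open>sdiff\<close>.\<close>

definition chi :: "nat set \<Rightarrow> nat set \<Rightarrow> real" where
  "chi u v = (-1) ^ card (u \<inter> v)"

lemma chi_commute: "chi u v = chi v u"
  by (simp add: chi_def Int_commute)

lemma chi_empty [simp]: "chi u {} = 1" "chi {} u = 1"
  by (simp_all add: chi_def)

lemma chi_square [simp]: "chi u v * chi u v = 1"
  by (simp add: chi_def flip: power_add) 

lemma chi_prod: "finite u \<Longrightarrow> chi u v = (\<Prod>i\<in>u. if i \<in> v then -1 else 1)"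
  by (simp add: chi_def prod.If_cases)

lemma chi_sdiff: "finite u \<Longrightarrow> chi u (sdiff v w) = chi u v * chi u w"
  unfolding chi_prod prod.distrib[symmetric] by (intro prod.cong) (auto simp: sdiff_def)

text \<open>For \<open>a\<close> in \<open>v\<close>, translating \<open>u\<close> by
  \<open>{a}\<close> changes the sign of \<open>chi u v\<close>, so the sum equals its own
  negative.\<close>

lemma sum_chi:
  assumes "v \<subseteq> {..<n}"
  shows "(\<Sum>u\<in>Pow {..<n}. chi u v) = (if v = {} then 2 ^ n else 0)"
proof (cases "v = {}")
  case True
  then show ?thesis by (simp add: card_Pow)
next
  case False
  then obtain a where a: "a \<in> v" by blast
  then have fin: "finite v" "{a} \<subseteq> {..<n}" using assms finite_subset by auto
  have "chi (sdiff {a} u) v = - chi u v" for u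
    using a chi_sdiff[OF fin(1), of "{a}" u] by (simp add: chi_commute[of _ v]) (simp add: chi_def)
  then have "(\<Sum>u\<in>Pow {..<n}. chi u v) = - (\<Sum>u\<in>Pow {..<n}. chi u v)"
    using sum_Pow_sdiff[OF fin(2), of "\<lambda>u. chi u v"] by (simp add: sum_negf)
  with False show ?thesis by simp
qed

definition ft :: "nat \<Rightarrow> (nat set \<Rightarrow> real) \<Rightarrow> nat set \<Rightarrow> real" where
  "ft n p u = (\<Sum>v\<in>Pow {..<n}. p v * chi u v)"

lemma sum_chi_chi:
  assumes "v \<subseteq> {..<n}" "w \<subseteq> {..<n}"
  shows "(\<Sum>u\<in>Pow {..<n}. chi u v * chi u w) = (if v = w then 2 ^ n else 0)"
proof -
  have "(\<Sum>u\<in>Pow {..<n}. chi u v * chi u w) = (\<Sum>u\<in>Pow {..<n}. chi u (sdiff v w))"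
    by (intro sum.cong refl) (subst chi_sdiff, auto intro: finite_subset)
  then show ?thesis
    using sum_chi[OF sdiff_subset[OF assms]] by simp
qed

text \<open>Parseval's identity: expand both transforms and use orthogonality of the
  characters.\<close>

lemma sum_ft_mult:
  "(\<Sum>u\<in>Pow {..<n}. ft n p u * ft n q u) = 2 ^ n * (\<Sum>v\<in>Pow {..<n}. p v * q v)"
proof -
  have "(\<Sum>u\<in>Pow {..<n}. ft n p u * ft n q u)
      = (\<Sum>u\<in>Pow {..<n}. \<Sum>v\<in>Pow {..<n}. \<Sum>w\<in>Pow {..<n}. p v * q w * (chi u v * chi u w))"
    unfolding ft_def sum_product by (intro sum.cong refl) (simp add: algebra_simps)
  also have "\<dots> = (\<Sum>v\<in>Pow {..<n}. \<Sum>w\<in>Pow {..<n}. \<Sum>u\<in>Pow {..<n}. p v * q w * (chi u v * chi u w))"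
    by (rule trans[OF sum.swap], rule sum.cong[OF refl], rule sum.swap)
  also have "\<dots> = (\<Sum>v\<in>Pow {..<n}. \<Sum>w\<in>Pow {..<n}. p v * q w * (if v = w then 2 ^ n else 0))"
    by (intro sum.cong refl) (simp add: sum_chi_chi flip: sum_distrib_left)
  also have "\<dots> = (\<Sum>v\<in>Pow {..<n}. p v * q v * 2 ^ n)"
    by (simp add: if_distrib sum.delta cong: if_cong)
  finally show ?thesis by (simp add: sum_distrib_left mult.commute)
qed

definition conv :: "nat \<Rightarrow> (nat set \<Rightarrow> real) \<Rightarrow> (nat set \<Rightarrow> real) \<Rightarrow> nat set \<Rightarrow> real" where
  "conv n p q v = (\<Sum>w\<in>Pow {..<n}. p w * q (sdiff w v))"

lemma ft_conv:
  assumes "u \<subseteq> {..<n}"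
  shows "ft n (conv n p q) u = ft n p u * ft n q u"
proof -
  have fin: "finite u" using assms finite_subset by blast
  have "ft n (conv n p q) u
      = (\<Sum>w\<in>Pow {..<n}. \<Sum>v\<in>Pow {..<n}. p w * q (sdiff w v) * chi u v)"
    unfolding ft_def conv_def sum_distrib_right by (rule sum.swap)
  also have "\<dots> = (\<Sum>w\<in>Pow {..<n}. \<Sum>v\<in>Pow {..<n}. p w * q v * chi u (sdiff w v))"
  proof (rule sum.cong[OF refl])
    fix w assume "w \<in> Pow {..<n}"
    then show "(\<Sum>v\<in>Pow {..<n}. p w * q (sdiff w v) * chi u v)
        = (\<Sum>v\<in>Pow {..<n}. p w * q v * chi u (sdiff w v))"
      using sum_Pow_sdiff[of w "{..<n}" "\<lambda>v. p w * q v * chi u (sdiff w v)"] by simp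
  qed
  also have "\<dots> = ft n p u * ft n q u"
    unfolding ft_def sum_product by (intro sum.cong refl) (simp add: chi_sdiff[OF fin])
  finally show ?thesis .
qed

text \<open>The squared transform of the indicator of \<open>Z\<close>, paired with
  \<open>F\<close>. For \<open>F = ft n p\<close> this is, up to the factor \<open>2 ^ n\<close>,
  the sum of \<open>p\<close> over all differences of codewords.\<close>

definition energy :: "nat \<Rightarrow> nat set set \<Rightarrow> (nat set \<Rightarrow> real) \<Rightarrow> real" where
  "energy n Z F = (\<Sum>u\<in>Pow {..<n}. (\<Sum>z\<in>Z. chi u z)\<^sup>2 * F u)"

lemma energy_ft:
  assumes "Z \<subseteq> Pow {..<n}"
  shows "energy n Z (ft n p) = 2 ^ n * (\<Sum>z\<in>Z. \<Sum>z'\<in>Z. p (sdiff z z'))"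
proof -
  have "energy n Z (ft n p)
      = (\<Sum>u\<in>Pow {..<n}. \<Sum>z\<in>Z. \<Sum>z'\<in>Z. \<Sum>v\<in>Pow {..<n}. p v * (chi u (sdiff z z') * chi u v))"
    unfolding energy_def power2_eq_square sum_product
    unfolding ft_def sum_distrib_right
    unfolding sum_distrib_left
  proof (intro sum.cong refl)
    fix u z z' v assume "u \<in> Pow {..<n}"
    then have "finite u" using finite_subset by blast
    then show "chi u z * chi u z' * (p v * chi u v) = p v * (chi u (sdiff z z') * chi u v)"
      by (simp add: chi_sdiff)
  qed
  also have "\<dots> = (\<Sum>z\<in>Z. \<Sum>z'\<in>Z. \<Sum>v\<in>Pow {..<n}. \<Sum>u\<in>Pow {..<n}. p v * (chi u (sdiff z z') * chi u v))"
    by (rule trans[OF sum.swap], rule sum.cong[OF refl], rule trans[OF sum.swap],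
        rule sum.cong[OF refl], rule sum.swap)
  also have "\<dots> = (\<Sum>z\<in>Z. \<Sum>z'\<in>Z. \<Sum>v\<in>Pow {..<n}. p v * (if sdiff z z' = v then 2 ^ n else 0))"
  proof (intro sum.cong refl)
    fix z z' v assume "z \<in> Z" "z' \<in> Z" "v \<in> Pow {..<n}"
    then have "sdiff z z' \<subseteq> {..<n}" "v \<subseteq> {..<n}" using assms by (auto simp: sdiff_def)
    then show "(\<Sum>u\<in>Pow {..<n}. p v * (chi u (sdiff z z') * chi u v))
        = p v * (if sdiff z z' = v then 2 ^ n else 0)"
      unfolding sum_distrib_left[symmetric] by (simp only: sum_chi_chi)
  qed
  also have "\<dots> = (\<Sum>z\<in>Z. \<Sum>z'\<in>Z. p (sdiff z z') * 2 ^ n)"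
  proof (intro sum.cong refl)
    fix z z' assume "z \<in> Z" "z' \<in> Z"
    then have "sdiff z z' \<in> Pow {..<n}" using assms by (auto simp: sdiff_def)
    then show "(\<Sum>v\<in>Pow {..<n}. p v * (if sdiff z z' = v then 2 ^ n else 0)) = p (sdiff z z') * 2 ^ n"
      by (simp add: if_distrib sum.delta' cong: if_cong)
  qed
  finally show ?thesis by (simp add: sum_distrib_left mult.commute)
qed

section \<open>Functions whose transform is supported on words of low weight\<close>

definition band_limited :: "nat \<Rightarrow> nat \<Rightarrow> (nat set \<Rightarrow> real) \<Rightarrow> bool" where
  "band_limited n d F \<longleftrightarrow>
     (\<exists>p. (\<forall>v\<in>Pow {..<n}. p v \<noteq> 0 \<longrightarrow> card v \<le> d) \<and> (\<forall>u\<in>Pow {..<n}. F u = ft n p u))"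

definition pos_band_limited :: "nat \<Rightarrow> nat \<Rightarrow> (nat set \<Rightarrow> real) \<Rightarrow> bool" where
  "pos_band_limited n d F \<longleftrightarrow>
     (\<exists>p. (\<forall>v\<in>Pow {..<n}. p v \<ge> 0 \<and> (p v \<noteq> 0 \<longrightarrow> card v \<le> d)) \<and> (\<forall>u\<in>Pow {..<n}. F u = ft n p u))"

text \<open>A nonzero term splits \<open>v\<close> into \<open>w\<close> and
  \<open>sdiff w v\<close>, both in the supports, and weights are subadditive.\<close>

lemma conv_support:
  assumes "\<forall>v\<in>Pow {..<n}. p v \<noteq> 0 \<longrightarrow> card v \<le> d" "\<forall>v\<in>Pow {..<n}. q v \<noteq> 0 \<longrightarrow> card v \<le> d'"
    and "v \<in> Pow {..<n}" "conv n p q v \<noteq> 0"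
  shows "card v \<le> d + d'"
proof -
  obtain w where w: "w \<in> Pow {..<n}" "p w * q (sdiff w v) \<noteq> 0"
    using assms(4) unfolding conv_def by (meson sum.not_neutral_contains_not_neutral)
  then have "card w \<le> d" "card (sdiff w v) \<le> d'"
    using assms sdiff_subset[of w "{..<n}" v] by auto
  moreover have "card (sdiff w (sdiff w v)) \<le> card w + card (sdiff w v)"
    using w assms(3) by (intro card_sdiff_le finite_sdiff) (auto intro: finite_subset)
  ultimately show ?thesis by simp
qed

lemma band_limited_mult:
  assumes "band_limited n d F" "band_limited n d' G"
  shows "band_limited n (d + d') (\<lambda>u. F u * G u)"
proof -
  obtain p q where "\<forall>v\<in>Pow {..<n}. p v \<noteq> 0 \<longrightarrow> card v \<le> d" "\<forall>v\<in>Pow {..<n}. q v \<noteq> 0 \<longrightarrow> card v \<le> d'"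
    "\<forall>u\<in>Pow {..<n}. F u = ft n p u" "\<forall>u\<in>Pow {..<n}. G u = ft n q u"
    using assms unfolding band_limited_def by blast
  then show ?thesis
    unfolding band_limited_def using conv_support[of n p d q d']
    by (intro exI[of _ "conv n p q"]) (auto simp: ft_conv)
qed

lemma band_limited_add:
  assumes "band_limited n d F" "band_limited n d G"
  shows "band_limited n d (\<lambda>u. F u + G u)"
proof -
  obtain p q where "\<forall>v\<in>Pow {..<n}. p v \<noteq> 0 \<longrightarrow> card v \<le> d" "\<forall>v\<in>Pow {..<n}. q v \<noteq> 0 \<longrightarrow> card v \<le> d"
    "\<forall>u\<in>Pow {..<n}. F u = ft n p u" "\<forall>u\<in>Pow {..<n}. G u = ft n q u"
    using assms unfolding band_limited_def by blast
  then show ?thesis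
    unfolding band_limited_def
    by (intro exI[of _ "\<lambda>v. p v + q v"]) (force simp: ft_def sum.distrib algebra_simps)
qed

lemma band_limited_mono: "band_limited n d F \<Longrightarrow> d \<le> d' \<Longrightarrow> band_limited n d' F"
  unfolding band_limited_def by (meson order_trans)

lemma band_limited_const: "band_limited n 0 (\<lambda>u. c)"
  unfolding band_limited_def
  by (intro exI[of _ "\<lambda>v. if v = {} then c else 0"])
     (auto simp: ft_def if_distribR if_distrib sum.delta cong: if_cong)

lemma card_eq_sum_chi:
  assumes "u \<subseteq> {..<n}"
  shows "real (card u) = (\<Sum>a<n. (1 - chi u {a}) / 2)"
proof -
  have "(\<Sum>a<n. (1 - chi u {a}) / 2) = (\<Sum>a<n. if a \<in> u then 1 else 0)"
    by (intro sum.cong) (auto simp: chi_def)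
  also have "\<dots> = real (card u)"
    using assms by (simp add: sum.If_cases Int_absorb1)
  finally show ?thesis by simp
qed

text \<open>The weight is an affine function of the characters of single coordinates;
  \<open>p\<close> collects their coefficients.\<close>

lemma band_limited_card: "band_limited n 1 (\<lambda>u. real (card u))"
proof -
  define p :: "nat set \<Rightarrow> real" where "p v = (\<Sum>a<n. ((if v = {} then 1 else 0) - (if v = {a} then 1 else 0)) / 2)" for v
  have "card v \<le> 1" if "p v \<noteq> 0" for v
  proof -
    from that obtain a where "((if v = {} then 1 else 0) - (if v = {a} then 1 else 0)) / (2::real) \<noteq> 0"
      unfolding p_def by (meson sum.not_neutral_contains_not_neutral)
    then show ?thesis by (auto split: if_splits)
  qed
  moreover have "real (card u) = ft n p u" if "u \<subseteq> {..<n}" for u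
  proof -
    have "ft n p u = (\<Sum>a<n. \<Sum>v\<in>Pow {..<n}. ((if v = {} then 1 else 0) - (if v = {a} then 1 else 0)) / 2 * chi u v)"
      unfolding ft_def p_def sum_distrib_right by (rule sum.swap)
    also have "\<dots> = (\<Sum>a<n. (1 - chi u {a}) / 2)"
    proof (intro sum.cong refl)
      fix a assume a: "a \<in> {..<n}"
      have "(\<Sum>v\<in>Pow {..<n}. ((if v = {} then 1 else 0) - (if v = {a} then 1 else 0)) / 2 * chi u v)
          = (\<Sum>v\<in>Pow {..<n}. (if v = {} then 1 / 2 else 0) - (if v = {a} then chi u {a} / 2 else 0))"
        by (intro sum.cong) (auto simp: field_simps)
      also have "\<dots> = (1 - chi u {a}) / 2"
        using a by (simp add: sum_subtractf sum.delta diff_divide_distrib)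
      finally show "(\<Sum>v\<in>Pow {..<n}. ((if v = {} then 1 else 0) - (if v = {a} then 1 else 0)) / 2 * chi u v)
          = (1 - chi u {a}) / 2" .
    qed
    finally show ?thesis using card_eq_sum_chi[OF that] by simp
  qed
  ultimately show ?thesis
    unfolding band_limited_def by blast
qed

text \<open>Horner's scheme: each multiplication by the affine variable raises the weight bound by
  one.\<close>

lemma band_limited_poly:
  "band_limited n (degree f) (\<lambda>u. poly f (real n + 1 - real (card u)))"
proof (induction f)
  case 0
  show ?case using band_limited_const[of n 0] by simp
next
  case (pCons a f)
  have bl1: "band_limited n 1 (\<lambda>u. real n + 1 - real (card u))"
    using band_limited_add[OF band_limited_mono[OF band_limited_const[of n "real n + 1"]]
        band_limited_mult[OF band_limited_const[of n "-1"] band_limited_card[of n]], of ] by simp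
  show ?case
  proof (cases "f = 0")
    case True
    then show ?thesis using band_limited_const[of n a] by simp
  next
    case False
    then show ?thesis
      using band_limited_add[OF band_limited_mono[OF band_limited_const[of n a]]
          band_limited_mult[OF bl1 pCons.IH]] by simp
  qed
qed

lemma pos_band_limited_mono: "pos_band_limited n d F \<Longrightarrow> d \<le> d' \<Longrightarrow> pos_band_limited n d' F"
  unfolding pos_band_limited_def by (meson order_trans)

lemma pos_band_limited_add:
  assumes "pos_band_limited n d F" "pos_band_limited n d G"
  shows "pos_band_limited n d (\<lambda>u. F u + G u)"
proof -
  obtain p q where "\<forall>v\<in>Pow {..<n}. p v \<ge> 0 \<and> (p v \<noteq> 0 \<longrightarrow> card v \<le> d)"
    "\<forall>v\<in>Pow {..<n}. q v \<ge> 0 \<and> (q v \<noteq> 0 \<longrightarrow> card v \<le> d)"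
    "\<forall>u\<in>Pow {..<n}. F u = ft n p u" "\<forall>u\<in>Pow {..<n}. G u = ft n q u"
    using assms unfolding pos_band_limited_def by blast
  then show ?thesis
    unfolding pos_band_limited_def
    by (intro exI[of _ "\<lambda>v. p v + q v"]) (force simp: ft_def sum.distrib algebra_simps)
qed

lemma pos_band_limited_scale:
  assumes "pos_band_limited n d F" "c \<ge> 0"
  shows "pos_band_limited n d (\<lambda>u. c * F u)"
proof -
  obtain p where "\<forall>v\<in>Pow {..<n}. p v \<ge> 0 \<and> (p v \<noteq> 0 \<longrightarrow> card v \<le> d)"
    "\<forall>u\<in>Pow {..<n}. F u = ft n p u"
    using assms unfolding pos_band_limited_def by blast
  then show ?thesis
    unfolding pos_band_limited_def using assms(2)
    by (intro exI[of _ "\<lambda>v. c * p v"]) (auto simp: ft_def sum_distrib_left algebra_simps)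
qed

lemma pos_band_limited_0: "pos_band_limited n d (\<lambda>u. 0)"
  unfolding pos_band_limited_def by (intro exI[of _ "\<lambda>v. 0"]) (auto simp: ft_def)

lemma pos_band_limited_sum:
  assumes "\<And>i. i \<in> I \<Longrightarrow> pos_band_limited n d (F i)"
  shows "pos_band_limited n d (\<lambda>u. \<Sum>i\<in>I. F i u)"
  using assms
  by (induction I rule: infinite_finite_induct) (auto intro: pos_band_limited_add pos_band_limited_0)

lemma pos_band_limited_mult:
  assumes "pos_band_limited n d F" "pos_band_limited n d' G"
  shows "pos_band_limited n (d + d') (\<lambda>u. F u * G u)"
proof -
  obtain p q where *: "\<forall>v\<in>Pow {..<n}. p v \<ge> 0 \<and> (p v \<noteq> 0 \<longrightarrow> card v \<le> d)"
    "\<forall>v\<in>Pow {..<n}. q v \<ge> 0 \<and> (q v \<noteq> 0 \<longrightarrow> card v \<le> d')"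
    "\<forall>u\<in>Pow {..<n}. F u = ft n p u" "\<forall>u\<in>Pow {..<n}. G u = ft n q u"
    using assms unfolding pos_band_limited_def by blast
  moreover have "conv n p q v \<ge> 0" if "v \<in> Pow {..<n}" for v
    unfolding conv_def using * that sdiff_subset[of _ "{..<n}" v] by (intro sum_nonneg mult_nonneg_nonneg) auto
  ultimately show ?thesis
    unfolding pos_band_limited_def using conv_support[of n p d q d']
    by (intro exI[of _ "conv n p q"]) (auto simp: ft_conv)
qed

text \<open>Differences of distinct codewords lie outside the support of \<open>p\<close>, so only
  the diagonal pairs survive. This makes a well-separated code a quadrature rule for functions of
  low band.\<close>

lemma energy_band_limited:
  assumes Z: "Z \<subseteq> Pow {..<n}"
    and sep: "\<And>z z'. z \<in> Z \<Longrightarrow> z' \<in> Z \<Longrightarrow> z \<noteq> z' \<Longrightarrow> d < card (sdiff z z')"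
    and "band_limited n d F"
  shows "energy n Z F = real (card Z) * (\<Sum>u\<in>Pow {..<n}. F u)"
proof -
  obtain p where p: "\<forall>v\<in>Pow {..<n}. p v \<noteq> 0 \<longrightarrow> card v \<le> d" "\<forall>u\<in>Pow {..<n}. F u = ft n p u"
    using assms(3) unfolding band_limited_def by blast
  have fin: "finite Z" using Z finite_subset by blast
  have "(\<Sum>z'\<in>Z. p (sdiff z z')) = p {}" if "z \<in> Z" for z
  proof -
    have "p (sdiff z z') = (if z' = z then p {} else 0)" if "z' \<in> Z" for z'
      using p(1) sep[OF \<open>z \<in> Z\<close> that] sdiff_subset[of z "{..<n}" z'] \<open>z \<in> Z\<close> that Z by force
    then show ?thesis using fin that by (simp add: sum.delta)
  qed
  moreover have "(\<Sum>u\<in>Pow {..<n}. F u) = 2 ^ n * p {}"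
  proof -
    \<comment> \<open>The code consisting of the empty word alone has transform 1, which reads off
      the value \<open>p {}\<close>.\<close>
    have "(\<Sum>u\<in>Pow {..<n}. F u) = energy n {{}} (ft n p)"
      unfolding energy_def using p(2) by (intro sum.cong) auto
    then show ?thesis by (subst (asm) energy_ft) auto
  qed
  moreover have "energy n Z F = energy n Z (ft n p)"
    unfolding energy_def using p(2) by (intro sum.cong) auto
  ultimately show ?thesis
    using energy_ft[OF Z, of p] by simp
qed

text \<open>The linear programming bound: for \<open>Z\<close> only diagonal pairs contribute, while
  for \<open>Z'\<close> the same diagonal is joined by nonnegative terms.\<close>

lemma energy_pos_band_limited_le:
  assumes Z: "Z \<subseteq> Pow {..<n}" "Z' \<subseteq> Pow {..<n}" "card Z' = card Z"
    and sep: "\<And>z z'. z \<in> Z \<Longrightarrow> z' \<in> Z \<Longrightarrow> z \<noteq> z' \<Longrightarrow> d < card (sdiff z z')"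
    and F: "pos_band_limited n d F"
  shows "energy n Z F \<le> energy n Z' F"
proof -
  obtain p where p: "\<forall>v\<in>Pow {..<n}. p v \<ge> 0 \<and> (p v \<noteq> 0 \<longrightarrow> card v \<le> d)"
    "\<forall>u\<in>Pow {..<n}. F u = ft n p u"
    using F unfolding pos_band_limited_def by blast
  have fin: "finite Z" "finite Z'" using Z finite_subset by blast+
  have F_eq: "energy n Y F = 2 ^ n * (\<Sum>z\<in>Y. \<Sum>z'\<in>Y. p (sdiff z z'))" if "Y \<subseteq> Pow {..<n}" for Y
    unfolding energy_ft[OF that, symmetric] unfolding energy_def using p(2) by (intro sum.cong) auto
  have "(\<Sum>z'\<in>Z. p (sdiff z z')) = p {}" if "z \<in> Z" for z
  proof -
    have "p (sdiff z z') = (if z' = z then p {} else 0)" if "z' \<in> Z" for z'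
      using p(1) sep[OF \<open>z \<in> Z\<close> that] sdiff_subset[of z "{..<n}" z'] \<open>z \<in> Z\<close> that Z by force
    then show ?thesis using fin that by (simp add: sum.delta)
  qed
  moreover have "(\<Sum>z'\<in>Z'. p (sdiff z z')) \<ge> p {}" if "z \<in> Z'" for z
  proof -
    have "p (sdiff z z) \<le> (\<Sum>z'\<in>Z'. p (sdiff z z'))"
      using that fin(2) p(1) Z(2) sdiff_subset[of z "{..<n}"] by (intro member_le_sum) blast+
    then show ?thesis by simp
  qed
  ultimately have "(\<Sum>z\<in>Z. \<Sum>z'\<in>Z. p (sdiff z z')) \<le> (\<Sum>z\<in>Z'. \<Sum>z'\<in>Z'. p (sdiff z z'))"
    using sum_mono[of Z' "\<lambda>z. p {}" "\<lambda>z. \<Sum>z'\<in>Z'. p (sdiff z z')"] Z(3) by simp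
  then show ?thesis by (simp add: F_eq Z)
qed

section \<open>Interpolation and orthogonal polynomials\<close>

definition nonneg_coeffs :: "real poly \<Rightarrow> bool" where
  "nonneg_coeffs f \<longleftrightarrow> (\<forall>i. coeff f i \<ge> 0)"

lemma nonneg_coeffs_pCons: "nonneg_coeffs (pCons a f) \<longleftrightarrow> a \<ge> 0 \<and> nonneg_coeffs f"
  by (auto simp: nonneg_coeffs_def coeff_pCons split: nat.splits)

lemma poly_nonneg_coeffs: "nonneg_coeffs f \<Longrightarrow> x \<ge> 0 \<Longrightarrow> poly f x \<ge> 0"
  by (induction f) (auto simp: nonneg_coeffs_pCons)

text \<open>By Horner's scheme the coefficients of the quotient are values at \<open>c\<close> of
  the tails of \<open>f\<close>.\<close>

lemma nonneg_coeffs_synthetic_div: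
  "nonneg_coeffs f \<Longrightarrow> c \<ge> 0 \<Longrightarrow> nonneg_coeffs (synthetic_div f c)"
  by (induction f) (auto simp: nonneg_coeffs_pCons poly_nonneg_coeffs)

text \<open>Divide by one linear factor at a time; each quotient keeps nonnegative coefficients
  because the nodes are positive.\<close>

lemma newton_remainder:
  assumes "finite T" "\<And>t. t \<in> T \<Longrightarrow> t > 0" "nonneg_coeffs f"
  obtains A g where "f = A + (\<Prod>t\<in>T. [:-t, 1:]) * g" "nonneg_coeffs g" "A = 0 \<or> degree A < card T"
proof -
  have "\<exists>A g. f = A + (\<Prod>t\<in>T. [:-t, 1:]) * g \<and> nonneg_coeffs g \<and> (A = 0 \<or> degree A < card T)"
    using assms
  proof (induction T arbitrary: f rule: finite_induct)
    case empty
    then show ?case by (intro exI[of _ 0] exI[of _ f]) auto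
  next
    case (insert s T)
    have "nonneg_coeffs (synthetic_div f s)"
      using insert.prems by (intro nonneg_coeffs_synthetic_div) (auto intro: less_imp_le)
    then obtain A g where *: "synthetic_div f s = A + (\<Prod>t\<in>T. [:-t, 1:]) * g" "nonneg_coeffs g"
      "A = 0 \<or> degree A < card T"
      using insert.IH[of "synthetic_div f s"] insert.prems by auto
    let ?A = "[:-s, 1:] * A + [:poly f s:]"
    have "f = ?A + (\<Prod>t\<in>insert s T. [:-t, 1:]) * g"
      using synthetic_div_correct'[of s f] insert.hyps unfolding *(1)
      by (simp add: algebra_simps)
    moreover have "degree ?A < card (insert s T)"
    proof -
      have "degree ?A \<le> max (degree ([:-s, 1:] * A)) (degree [:poly f s:])"
        by (rule degree_add_le_max)
      moreover have "degree ([:-s, 1:] * A) < card (insert s T)"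
        using *(3) insert.hyps degree_mult_le[of "[:-s, 1:]" A] by auto
      ultimately show ?thesis using insert.hyps by simp
    qed
    ultimately show ?case using *(2) by blast
  qed
  then show ?thesis using that by blast
qed

section \<open>Orthogonal polynomials for a weight on a finite set\<close>

text \<open>The bound \<open>j\<close> is kept apart from the degree of \<open>P\<close>, so that
  the intermediate stages of Gram-Schmidt can be expressed.\<close>

definition orthogonal_to_lower :: "real set \<Rightarrow> (real \<Rightarrow> real) \<Rightarrow> nat \<Rightarrow> real poly \<Rightarrow> bool" where
  "orthogonal_to_lower T w j P \<longleftrightarrow>
     (\<forall>q. degree q < j \<longrightarrow> (\<Sum>t\<in>T. w t * poly P t * poly q t) = 0)"

text \<open>A test polynomial of degree \<open>j\<close> is a multiple of \<open>P\<close> plus one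
  of lower degree.\<close>

lemma orthogonal_to_lower_Suc:
  assumes P: "degree P = j" "P \<noteq> 0" "orthogonal_to_lower T w j Q"
    and "(\<Sum>t\<in>T. w t * poly Q t * poly P t) = 0"
  shows "orthogonal_to_lower T w (Suc j) Q"
  unfolding orthogonal_to_lower_def
proof (intro allI impI)
  fix q :: "real poly" assume q: "degree q < Suc j"
  show "(\<Sum>t\<in>T. w t * poly Q t * poly q t) = 0"
  proof (cases "degree q < j")
    case True
    then show ?thesis using P(3) by (auto simp: orthogonal_to_lower_def)
  next
    case False
    with q have dq: "degree q = j" by simp
    define c where "c = lead_coeff q / lead_coeff P"
    define r where "r = q - smult c P"
    have "coeff P j \<noteq> 0" using P by auto
    then have "coeff r j = 0" using P dq by (simp add: r_def c_def)
    moreover have "degree r \<le> j" unfolding r_def using P dq by (intro degree_diff_le) auto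
    ultimately have r: "degree r < j \<or> r = 0"
      using eq_zero_or_degree_less by blast
    have "(\<Sum>t\<in>T. w t * poly Q t * poly q t)
        = c * (\<Sum>t\<in>T. w t * poly Q t * poly P t) + (\<Sum>t\<in>T. w t * poly Q t * poly r t)"
      by (simp add: r_def sum_distrib_left algebra_simps flip: sum.distrib)
    also have "\<dots> = 0"
      using assms(4) r P(3) by (auto simp: orthogonal_to_lower_def)
    finally show ?thesis .
  qed
qed

text \<open>If \<open>P\<close> has norm 0, then it vanishes on \<open>T\<close>, so the
  coefficient \<open>x / 0 = 0\<close> of the Gram-Schmidt projection is still the right one.\<close>

lemma project_orthogonal:
  fixes w :: "real \<Rightarrow> real"
  assumes "finite T" "\<And>t. t \<in> T \<Longrightarrow> w t > 0"
  shows "(\<Sum>t\<in>T. w t * (poly Q t -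
           (\<Sum>t\<in>T. w t * poly Q t * poly P t) / (\<Sum>t\<in>T. w t * poly P t * poly P t) * poly P t) * poly P t) = 0"
proof (cases "(\<Sum>t\<in>T. w t * poly P t * poly P t) = 0")
  case True
  have "w t * poly P t * poly P t = 0" if "t \<in> T" for t
    using True that assms sum_nonneg_eq_0_iff[of T "\<lambda>t. w t * poly P t * poly P t"]
    by (simp add: mult.assoc less_imp_le)
  then have "poly P t = 0" if "t \<in> T" for t using that assms(2) by force
  then show ?thesis by simp
next
  case False
  define c where "c = (\<Sum>t\<in>T. w t * poly Q t * poly P t) / (\<Sum>t\<in>T. w t * poly P t * poly P t)"
  have "(\<Sum>t\<in>T. w t * (poly Q t - c * poly P t) * poly P t)
      = (\<Sum>t\<in>T. w t * poly Q t * poly P t) - c * (\<Sum>t\<in>T. w t * poly P t * poly P t)"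
    by (simp add: sum_distrib_left algebra_simps flip: sum_subtractf)
  also have "\<dots> = 0" using False by (simp add: c_def)
  finally show ?thesis by (simp add: c_def)
qed

lemma orthogonal_to_lower_diff:
  assumes "orthogonal_to_lower T w j P" "orthogonal_to_lower T w j Q"
  shows "orthogonal_to_lower T w j (P - smult c Q)"
  unfolding orthogonal_to_lower_def
proof (intro allI impI)
  fix q :: "real poly" assume "degree q < j"
  then have "(\<Sum>t\<in>T. w t * poly P t * poly q t) - c * (\<Sum>t\<in>T. w t * poly Q t * poly q t) = 0"
    using assms by (simp add: orthogonal_to_lower_def)
  then show "(\<Sum>t\<in>T. w t * poly (P - smult c Q) t * poly q t) = 0"
    by (simp add: sum_distrib_left algebra_simps flip: sum_subtractf)
qed

text \<open>Gram-Schmidt starting from \<open>monom 1 j\<close>: the inner induction removes the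
  component along the orthogonal polynomial of degree \<open>i\<close>, which leaves the leading
  term intact as \<open>i < j\<close>.\<close>

lemma exists_orthogonal_poly:
  assumes "finite T" "\<And>t. t \<in> T \<Longrightarrow> w t > 0"
  shows "\<exists>P. degree P = j \<and> lead_coeff P = 1 \<and> orthogonal_to_lower T w j P"
proof (induction j rule: less_induct)
  case (less j)
  have "\<exists>P. degree P = j \<and> lead_coeff P = 1 \<and> orthogonal_to_lower T w i P" if "i \<le> j" for i
    using that
  proof (induction i)
    case 0
    show ?case by (intro exI[of _ "monom 1 j"]) (simp add: orthogonal_to_lower_def degree_monom_eq)
  next
    case (Suc i)
    then obtain P where P: "degree P = j" "lead_coeff P = 1" "orthogonal_to_lower T w i P" by auto
    obtain R where R: "degree R = i" "lead_coeff R = 1" "orthogonal_to_lower T w i R"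
      using less.IH[of i] Suc.prems by auto
    define c where "c = (\<Sum>t\<in>T. w t * poly P t * poly R t) / (\<Sum>t\<in>T. w t * poly R t * poly R t)"
    have "orthogonal_to_lower T w (Suc i) (P - smult c R)"
      by (rule orthogonal_to_lower_Suc[OF R(1) _ orthogonal_to_lower_diff[OF P(3) R(3)]])
         (use R project_orthogonal[of T w P R] assms in \<open>auto simp: c_def\<close>)
    moreover have "degree (smult c R) < j" using R Suc.prems degree_smult_le[of c R] by linarith
    then have "degree (P - smult c R) = j"
      using P(1) degree_add_eq_left[of "- smult c R" P] by simp
    moreover from this have "lead_coeff (P - smult c R) = 1"
      using P coeff_eq_0[OF \<open>degree (smult c R) < j\<close>] by simp
    ultimately show ?case by blast
  qed
  then show ?case by blast
qed

text \<open>This is the positivity of the coefficients of Newton's interpolation basis in the orthogonal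
  polynomials. Removing the least node turns the weight \<open>w\<close> into \<open>(t - Min T) w\<close>,
  and every orthogonal polynomial of the old weight is a nonnegative combination of two
  consecutive ones of the new weight.\<close>

lemma nonneg_coeffs_inner_orthogonal:
  assumes "finite T" "\<And>t. t \<in> T \<Longrightarrow> t > 0" "\<And>t. t \<in> T \<Longrightarrow> w t > 0" "nonneg_coeffs f"
    and "degree P = j" "lead_coeff P \<ge> 0" "orthogonal_to_lower T w j P"
  shows "(\<Sum>t\<in>T. w t * poly f t * poly P t) \<ge> 0"
  using assms
proof (induction "card T" arbitrary: T w f P j)
  case 0
  then show ?case by simp
next
  case (Suc k)
  define s where "s = Min T"
  have s: "s \<in> T" "\<And>t. t \<in> T \<Longrightarrow> s \<le> t"
    using Suc.hyps(2) Suc.prems(1) by (auto simp: s_def intro!: Min_in)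
  define T' where "T' = T - {s}"
  define w' where "w' t = w t * (t - s)" for t
  define f' where "f' = synthetic_div f s"
  have T': "finite T'" "card T' = k" "\<And>t. t \<in> T' \<Longrightarrow> t > 0" "\<And>t. t \<in> T' \<Longrightarrow> w' t > 0"
    using Suc.prems Suc.hyps(2) s by (auto simp: T'_def w'_def less_le intro!: mult_pos_pos)
  have f': "nonneg_coeffs f'"
    unfolding f'_def using Suc.prems s by (intro nonneg_coeffs_synthetic_div) (auto intro: less_imp_le)
  have IH: "(\<Sum>t\<in>T'. w' t * poly f' t * poly R t) \<ge> 0"
    if "degree R = i" "lead_coeff R \<ge> 0" "orthogonal_to_lower T' w' i R" for R i
    using Suc.hyps(1)[OF T'(2)[symmetric] T'(1,3,4) f' that] by simp
  \<comment> \<open>The new weight vanishes at \<open>s\<close>, so sums over \<open>T'\<close>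
    extend to \<open>T\<close>.\<close>
  have shift: "(\<Sum>t\<in>T'. w' t * h t) = (\<Sum>t\<in>T. w t * (t - s) * h t)" for h
    unfolding w'_def T'_def using Suc.prems(1) s(1) by (simp add: sum.remove[of T s])
  have f_eq: "poly f t = poly f s + (t - s) * poly f' t" for t
    using arg_cong[OF synthetic_div_correct'[of s f], of "\<lambda>p. poly p t"]
    by (simp add: f'_def algebra_simps)
  have split: "(\<Sum>t\<in>T. w t * poly f t * poly P t)
      = poly f s * (\<Sum>t\<in>T. w t * poly P t) + (\<Sum>t\<in>T'. w' t * poly f' t * poly P t)"
  proof -
    have "(\<Sum>t\<in>T. w t * poly f t * poly P t)
        = (\<Sum>t\<in>T. poly f s * (w t * poly P t) + w t * (t - s) * (poly f' t * poly P t))"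
      by (intro sum.cong refl) (subst f_eq, simp add: algebra_simps)
    then show ?thesis
      using shift[of "\<lambda>t. poly f' t * poly P t"]
      by (simp add: sum.distrib sum_distrib_left mult.assoc)
  qed
  have "poly f s \<ge> 0" using Suc.prems s by (intro poly_nonneg_coeffs) (auto intro: less_imp_le)
  moreover have "(\<Sum>t\<in>T. w t * poly P t) \<ge> 0"
  proof (cases j)
    case 0
    then obtain c where "P = [:c:]" using Suc.prems(5) degree_eq_zeroE by blast
    then show ?thesis using Suc.prems(3,6) by (auto intro!: sum_nonneg mult_nonneg_nonneg simp: less_imp_le)
  next
    case (Suc i)
    then show ?thesis using Suc.prems(7) by (auto simp: orthogonal_to_lower_def dest!: spec[of _ 1])
  qed
  moreover have "(\<Sum>t\<in>T'. w' t * poly f' t * poly P t) \<ge> 0"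
  proof (cases j)
    case 0
    then show ?thesis using IH[of P 0] Suc.prems by (simp add: orthogonal_to_lower_def)
  next
    case j: (Suc i)
    obtain R where R: "degree R = i" "lead_coeff R = 1" "orthogonal_to_lower T' w' i R"
      using exists_orthogonal_poly[of T' w' i] T'(1,4) by blast
    \<comment> \<open>The Gram-Schmidt coefficient for the new weight. Then
      \<open>P - smult c R\<close> and \<open>R\<close> are the two consecutive orthogonal
      polynomials whose combination is \<open>P\<close>; it remains to see that \<open>c\<close> is
      nonnegative.\<close>
    define c where "c = (\<Sum>t\<in>T'. w' t * poly P t * poly R t) / (\<Sum>t\<in>T'. w' t * poly R t * poly R t)"
    have P_shift: "(\<Sum>t\<in>T'. w' t * poly P t * poly q t) = (\<Sum>t\<in>T. w t * poly P t * poly ([:-s, 1:] * q) t)" for q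
      using shift[of "\<lambda>t. poly P t * poly q t"] by (simp add: algebra_simps)
    have P_orth: "orthogonal_to_lower T' w' i P"
      unfolding orthogonal_to_lower_def P_shift
    proof (intro allI impI)
      fix q :: "real poly" assume "degree q < i"
      then have "degree ([:-s, 1:] * q) < j"
        using degree_mult_le[of "[:-s, 1:]" q] j by simp
      then show "(\<Sum>t\<in>T. w t * poly P t * poly ([:-s, 1:] * q) t) = 0"
        using Suc.prems(7) by (auto simp only: orthogonal_to_lower_def)
    qed
    define d where "d = lead_coeff P"
    define r where "r = P - smult d ([:-s, 1:] * R)"
    have R0: "R \<noteq> 0" using R(2) by auto
    have dR: "degree ([:-s, 1:] * R) = j" using R R0 j by (subst degree_mult_eq) auto
    have lR: "lead_coeff ([:-s, 1:] * R) = 1" using R(2) by (simp only: lead_coeff_mult) simp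
    have "coeff r j = 0" "degree r \<le> j"
      unfolding r_def using dR lR Suc.prems(5) by (auto simp: d_def intro!: degree_diff_le)
    then have r: "r = 0 \<or> degree r < j" using eq_zero_or_degree_less by blast
    \<comment> \<open>Multiplying \<open>R\<close> by \<open>d\<close> and the linear factor of
      \<open>s\<close> gives \<open>P\<close> up to lower degree, so the numerator of
      \<open>c\<close>, scaled by \<open>d\<close>, is the squared norm of \<open>P\<close> for the
      old weight.\<close>
    have "d * (\<Sum>t\<in>T'. w' t * poly P t * poly R t)
        = (\<Sum>t\<in>T. w t * poly P t * poly (P - r) t)"
      unfolding P_shift r_def by (simp add: sum_distrib_left algebra_simps)
    also have "\<dots> = (\<Sum>t\<in>T. w t * poly P t * poly P t) - (\<Sum>t\<in>T. w t * poly P t * poly r t)"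
      by (simp add: algebra_simps sum_subtractf)
    also have "(\<Sum>t\<in>T. w t * poly P t * poly r t) = 0"
      using r Suc.prems(7) by (auto simp: orthogonal_to_lower_def)
    also have "(\<Sum>t\<in>T. w t * poly P t * poly P t) - 0 \<ge> 0"
      using Suc.prems(3) by (auto intro!: sum_nonneg simp: mult.assoc less_imp_le)
    finally have "d * (\<Sum>t\<in>T'. w' t * poly P t * poly R t) \<ge> 0" .
    moreover have "d > 0"
      using Suc.prems(5,6) j leading_coeff_0_iff[of P] by (force simp: d_def less_le)
    ultimately have "c \<ge> 0"
      unfolding c_def using T'(4)
      by (intro divide_nonneg_nonneg) (auto intro!: sum_nonneg simp: zero_le_mult_iff mult.assoc less_imp_le)
    have "orthogonal_to_lower T' w' j (P - smult c R)"
      unfolding j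
      by (rule orthogonal_to_lower_Suc[OF R(1) R0 orthogonal_to_lower_diff[OF P_orth R(3)]])
         (use project_orthogonal[of T' w' P R] T'(1,4) in \<open>auto simp: c_def\<close>)
    moreover have deg: "degree (smult c R) < degree P" using R j Suc.prems(5) degree_smult_le[of c R] by linarith
    then have "degree (P - smult c R) = j"
      using Suc.prems(5) degree_add_eq_left[of "- smult c R" P] by simp
    moreover from this have "lead_coeff (P - smult c R) \<ge> 0"
      using Suc.prems(5,6) coeff_eq_0[OF deg] by auto
    ultimately have "(\<Sum>t\<in>T'. w' t * poly f' t * poly (P - smult c R) t) \<ge> 0"
      using IH by blast
    moreover have "c * (\<Sum>t\<in>T'. w' t * poly f' t * poly R t) \<ge> 0"
      using IH[OF R(1) _ R(3)] R(2) \<open>c \<ge> 0\<close> by simp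
    ultimately show ?thesis
      by (simp add: sum_distrib_left algebra_simps sum_subtractf)
  qed
  ultimately show ?case unfolding split by simp
qed

section \<open>Fourier transforms of balls\<close>

definition ball_ft :: "nat \<Rightarrow> nat \<Rightarrow> nat set \<Rightarrow> real" where
  "ball_ft n i = ft n (\<lambda>v. if card v \<le> i then 1 else 0)"

lemma pos_band_limited_ball_ft: "pos_band_limited n i (ball_ft n i)"
  unfolding pos_band_limited_def ball_ft_def
  by (intro exI[of _ "\<lambda>v. if card v \<le> i then 1 else 0"]) auto

text \<open>Expanding the product over coordinates chooses a word \<open>v\<close>; a coordinate
  contributes the factor \<open>1 - z\<close> inside \<open>u\<close> and \<open>1 + z\<close>
  outside.\<close>

lemma sum_monom_chi:
  assumes "u \<subseteq> {..<n}"
  shows "(\<Sum>v\<in>Pow {..<n}. monom (complex_of_real (chi u v)) (card v))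
       = [:1, -1:] ^ card u * [:1, 1:] ^ (n - card u)"
proof -
  have monom_prod: "(\<Prod>i\<in>v. monom (if i \<in> u then -1 else 1) (Suc 0)) = monom (complex_of_real (chi u v)) (card v)"
    if "finite v" for v
    using that
  proof (induction v rule: finite_induct)
    case (insert a v)
    then show ?case by (simp add: chi_commute[of u] chi_prod mult_monom)
  qed simp
  have "[:1, -1:] ^ card u * [:1, 1:] ^ (n - card u)
      = (\<Prod>i<n. if i \<in> u then [:1, -1:] else [:1, 1 :: complex:])"
    using assms by (simp add: prod.If_cases Int_absorb1 card_Diff_subset finite_subset flip: Diff_eq)
  also have "\<dots> = (\<Prod>i<n. monom (if i \<in> u then -1 else 1) (Suc 0) + 1)"
    by (intro prod.cong refl) (auto simp: monom_Suc monom_0 one_pCons)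
  also have "\<dots> = (\<Sum>v\<in>Pow {..<n}. monom (complex_of_real (chi u v)) (card v))"
    by (subst prod_add) (auto intro!: sum.cong monom_prod dest: finite_subset)
  finally show ?thesis by simp
qed

text \<open>Dividing the generating polynomial of the spheres by \<open>1 - z\<close> replaces
  coefficients by their partial sums, which passes from spheres to balls.\<close>

lemma coeff_eq_ball_ft:
  assumes "u \<subseteq> {..<n}" "u \<noteq> {}"
  shows "coeff ([:1, -1:] ^ (card u - 1) * [:1, 1:] ^ (n - card u)) i = complex_of_real (ball_ft n i u)"
proof -
  define Q :: "complex poly" where "Q = [:1, -1:] ^ (card u - 1) * [:1, 1:] ^ (n - card u)"
  have "card u > 0" using assms finite_subset card_gt_0_iff by blast
  then have Q: "[:1, -1:] * Q = (\<Sum>v\<in>Pow {..<n}. monom (complex_of_real (chi u v)) (card v))"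
    unfolding sum_monom_chi[OF assms(1)] Q_def mult.assoc[symmetric] by (simp add: power_eq_if)
  have step: "(\<Sum>v\<in>Pow {..<n}. complex_of_real (if card v = i then chi u v else 0))
      = coeff ([:1, -1:] * Q) i" for i
    unfolding Q coeff_sum coeff_monom by (intro sum.cong) auto
  show ?thesis
    unfolding Q_def[symmetric]
  proof (induction i)
    case 0
    have "coeff Q 0 = coeff ([:1, -1:] * Q) 0" by simp
    also have "\<dots> = complex_of_real (ball_ft n 0 u)"
      unfolding step[symmetric] ball_ft_def ft_def of_real_sum by (intro sum.cong) auto
    finally show ?case .
  next
    case (Suc i)
    have "coeff Q (Suc i) = coeff Q i + coeff ([:1, -1:] * Q) (Suc i)" by simp
    also have "\<dots> = complex_of_real (ball_ft n (Suc i) u)"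
      unfolding Suc step[symmetric] ball_ft_def ft_def of_real_sum sum.distrib[symmetric]
      by (intro sum.cong) auto
    finally show ?case .
  qed
qed

section \<open>The three-term recurrence and the Lloyd polynomials\<close>

lemma mult_pderiv_power:
  fixes a :: "'a :: {comm_ring_1, semiring_no_zero_divisors} poly"
  shows "a * pderiv (a ^ p) = smult (of_nat p) (pderiv a * a ^ p)"
  by (cases p) (simp_all add: pderiv_power_Suc algebra_simps del: power_Suc, simp add: algebra_simps)

text \<open>The logarithmic derivative of \<open>Q\<close> with the denominators cleared by
  \<open>(1 - z) (1 + z)\<close>.\<close>

lemma pderiv_one_minus_plus:
  fixes p q :: nat
  defines "Q \<equiv> [:1, -1:] ^ p * [:1, 1 :: complex:] ^ q"
  shows "[:1, 0, -1:] * pderiv Q = [:of_nat q - of_nat p, - of_nat (p + q):] * Q"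
proof -
  define a b :: "complex poly" where "a = [:1, -1:]" and "b = [:1, 1:]"
  have ab: "[:1, 0, -1:] = b * a" "pderiv a = -1" "pderiv b = 1"
    by (simp_all add: a_def b_def pderiv_pCons one_pCons)
  have "[:1, 0, -1:] * pderiv (a ^ p * b ^ q)
      = b * b ^ q * (a * pderiv (a ^ p)) + a * a ^ p * (b * pderiv (b ^ q))"
    unfolding ab(1) pderiv_mult by (simp only: ring_distribs mult_ac add_ac)
  also have "\<dots> = (smult (of_nat q) a - smult (of_nat p) b) * (a ^ p * b ^ q)"
    unfolding mult_pderiv_power ab(2,3)
    by (simp only: ring_distribs mult_smult_left mult_smult_right smult_minus_right
        mult_minus_left mult_minus_right mult_1_left diff_conv_add_uminus mult_ac add_ac)
  also have "smult (of_nat q) a - smult (of_nat p) b = [:of_nat q - of_nat p, - of_nat (p + q):]"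
    by (simp add: a_def b_def)
  finally show ?thesis by (simp only: Q_def a_def b_def)
qed

text \<open>Compare coefficients in the differential equation of the generating polynomial, with
  exponents \<open>card u - 1\<close> and \<open>n - card u\<close>.\<close>

lemma ball_ft_recurrence:
  assumes "u \<subseteq> {..<n}" "u \<noteq> {}"
  shows "ball_ft n 0 u = 1"
    and "ball_ft n (Suc 0) u = real n + 1 - 2 * real (card u)"
    and "(real i + 2) * ball_ft n (Suc (Suc i)) u
       = (real n + 1 - 2 * real (card u)) * ball_ft n (Suc i) u - (real n - (real i + 1)) * ball_ft n i u"
proof -
  define Q :: "complex poly" where "Q = [:1, -1:] ^ (card u - 1) * [:1, 1:] ^ (n - card u)"
  have fin: "finite u" using assms finite_subset by blast
  then have k: "card u > 0" "card u \<le> n"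
    using assms card_mono[of "{..<n}" u] by (simp_all add: card_gt_0_iff)
  have coeffQ: "coeff Q i = complex_of_real (ball_ft n i u)" for i
    unfolding Q_def by (rule coeff_eq_ball_ft[OF assms])
  have "(of_nat (n - card u) - of_nat (card u - 1)) = complex_of_real (real n + 1 - 2 * real (card u))"
    "of_nat (card u - 1 + (n - card u)) = complex_of_real (real n - 1)"
    using k by (simp_all add: of_nat_diff)
  then have ode: "[:1, 0, -1:] * pderiv Q = [:complex_of_real (real n + 1 - 2 * real (card u)), - complex_of_real (real n - 1):] * Q"
    unfolding Q_def pderiv_one_minus_plus by simp
  have "coeff Q 0 = 1"
    by (simp add: Q_def coeff_0_power coeff_mult_0)
  then show zero: "ball_ft n 0 u = 1" using coeffQ[of 0] by simp
  have "coeff ([:1, 0, -1:] * pderiv Q) 0 = coeff Q (Suc 0)"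
    by (simp add: coeff_pderiv coeff_mult_0)
  then have "complex_of_real (ball_ft n (Suc 0) u) = complex_of_real (real n + 1 - 2 * real (card u)) * coeff Q 0"
    unfolding ode coeffQ[symmetric] by (simp add: coeff_mult_0)
  then show "ball_ft n (Suc 0) u = real n + 1 - 2 * real (card u)"
    unfolding coeffQ zero of_real_1 mult_1_right of_real_eq_iff .
  have "coeff ([:1, 0, -1:] * pderiv Q) (Suc i) = (of_nat i + 2) * coeff Q (Suc (Suc i)) - of_nat i * coeff Q i"
    by (cases i) (simp_all add: coeff_pderiv algebra_simps)
  moreover have "coeff ([:complex_of_real (real n + 1 - 2 * real (card u)), - complex_of_real (real n - 1):] * Q) (Suc i)
    = complex_of_real (real n + 1 - 2 * real (card u)) * coeff Q (Suc i) - complex_of_real (real n - 1) * coeff Q i"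
    by (simp add: algebra_simps)
  ultimately have "complex_of_real ((real i + 2) * ball_ft n (Suc (Suc i)) u - real i * ball_ft n i u)
      = complex_of_real ((real n + 1 - 2 * real (card u)) * ball_ft n (Suc i) u - (real n - 1) * ball_ft n i u)"
    unfolding ode coeffQ by simp
  then show "(real i + 2) * ball_ft n (Suc (Suc i)) u
       = (real n + 1 - 2 * real (card u)) * ball_ft n (Suc i) u - (real n - (real i + 1)) * ball_ft n i u"
    unfolding of_real_eq_iff by (simp add: algebra_simps)
qed

text \<open>The variable is \<open>t = n + 1 - card u\<close>, so that \<open>t\<close> is positive at every word \<open>u\<close>.\<close>

fun lloyd_poly :: "nat \<Rightarrow> nat \<Rightarrow> real poly" where
  "lloyd_poly n 0 = 1"
| "lloyd_poly n (Suc 0) = [:- (real n + 1), 2:]"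
| "lloyd_poly n (Suc (Suc i)) = smult (1 / (real i + 2))
     ([:- (real n + 1), 2:] * lloyd_poly n (Suc i) - smult (real n - (real i + 1)) (lloyd_poly n i))"

lemma poly_lloyd_poly:
  assumes "u \<subseteq> {..<n}" "u \<noteq> {}"
  shows "poly (lloyd_poly n i) (real n + 1 - real (card u)) = ball_ft n i u"
proof (induction i rule: induct_nat_012)
  case (ge2 i)
  then show ?case
    using ball_ft_recurrence(3)[OF assms, of i] by (simp add: field_simps)
qed (simp_all add: ball_ft_recurrence(1,2)[OF assms])

text \<open>The linear factor of the recurrence is odd under the reflection, so parity alternates
  with the index.\<close>

lemma lloyd_poly_reflect: "poly (lloyd_poly n i) (real n + 1 - x) = (-1) ^ i * poly (lloyd_poly n i) x"
  by (induction n i rule: lloyd_poly.induct) (simp_all add: field_simps)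

lemma degree_lloyd_poly: "degree (lloyd_poly n i) = i \<and> lead_coeff (lloyd_poly n i) > 0"
proof (induction n i rule: lloyd_poly.induct)
  case (3 n i)
  let ?P = "[:- (real n + 1), 2:] * lloyd_poly n (Suc i)" and ?R = "smult (real n - (real i + 1)) (lloyd_poly n i)"
  have ne: "lloyd_poly n (Suc i) \<noteq> 0" using 3 by auto
  have P: "degree ?P = Suc (Suc i)" using 3 ne by (subst degree_mult_eq) auto
  have "lead_coeff ?P = 2 * lead_coeff (lloyd_poly n (Suc i))" by (simp only: lead_coeff_mult) simp
  with 3 have lP: "lead_coeff ?P > 0" by (metis mult_pos_pos zero_less_numeral)
  have R: "degree ?R < Suc (Suc i)" using 3 degree_smult_le[of "real n - (real i + 1)" "lloyd_poly n i"] by linarith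
  have d: "degree (?P - ?R) = Suc (Suc i)"
    using P R degree_add_eq_left[of "- ?R" ?P] by simp
  have "lead_coeff (?P - ?R) = lead_coeff ?P"
    unfolding d P using coeff_eq_0[OF R] by simp
  with lP d show ?case by (simp del: mult_pCons_left)
qed simp_all

section \<open>Sums of squared ball transforms\<close>

text \<open>The points are the roots of \<open>z ^ M = -1\<close>, a rotated copy of the
  \<open>M\<close>-th roots of unity. Exponents up to \<open>m\<close> differ by less than
  \<open>M\<close>, so distinct powers are orthogonal on them.\<close>

lemma parseval_roots_of_unity:
  fixes a :: "nat \<Rightarrow> real"
  assumes "m < M"
  shows "(\<Sum>j<M. (cmod (\<Sum>t\<le>m. of_real (a t) * cis (pi * (2 * real j + 1) / real M) ^ t))\<^sup>2)
       = real M * (\<Sum>t\<le>m. (a t)\<^sup>2)"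
proof -
  define z where "z j = cis (pi * (2 * real j + 1) / real M)" for j
  have orth: "(\<Sum>j<M. z j ^ t * cnj (z j ^ t')) = (if t = t' then of_nat M else 0)"
    if "t \<le> m" "t' \<le> m" for t t'
  proof -
    define \<theta> where "\<theta> = 2 * pi * (real t - real t') / real M"
    have "z j ^ t * cnj (z j ^ t') = cis (\<theta> / 2) * cis \<theta> ^ j" for j
      using assms unfolding z_def \<theta>_def cis_cnj DeMoivre cis_mult
      by (intro arg_cong[of _ _ cis]) (simp add: field_simps)
    then have "(\<Sum>j<M. z j ^ t * cnj (z j ^ t')) = cis (\<theta> / 2) * (\<Sum>j<M. cis \<theta> ^ j)"
      by (simp add: sum_distrib_left)
    moreover have "(\<Sum>j<M. cis \<theta> ^ j) = 0" if "t \<noteq> t'"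
    proof -
      have "cis \<theta> ^ M = 1"
      proof -
        have "real M * \<theta> = 2 * pi * of_int (int t - int t')" using assms by (simp add: \<theta>_def)
        then show ?thesis unfolding DeMoivre by (simp only: cis_multiple_2pi Ints_of_int)
      qed
      moreover have "cis \<theta> \<noteq> 1"
      proof
        assume "cis \<theta> = 1"
        then have "cos \<theta> = 1" by (metis cis.sel(1) one_complex.sel(1))
        then obtain k :: int where "\<theta> = of_int k * 2 * pi" using cos_one_2pi_int by blast
        then have "2 * pi * (real t - real t') = 2 * pi * (of_int k * real M)"
          using assms by (simp add: \<theta>_def divide_eq_eq mult_ac)
        then have "real_of_int (int t - int t') = real_of_int (k * int M)" by simp
        then have eq: "int t - int t' = k * int M" by linarith
        then have "k \<noteq> 0" using that by auto
        then have "1 \<le> \<bar>k\<bar>" by linarith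
        then have "int M \<le> \<bar>k * int M\<bar>" by (simp add: abs_mult mult_le_cancel_right1)
        with eq show False using \<open>t \<le> m\<close> \<open>t' \<le> m\<close> assms by linarith
      qed
      ultimately show ?thesis by (simp add: geometric_sum)
    qed
    moreover have "(\<Sum>j<M. cis \<theta> ^ j) = of_nat M" "cis (\<theta> / 2) = 1" if "t = t'"
      using that by (simp_all add: \<theta>_def)
    ultimately show ?thesis by auto
  qed
  have "complex_of_real (\<Sum>j<M. (cmod (\<Sum>t\<le>m. of_real (a t) * z j ^ t))\<^sup>2)
      = (\<Sum>j<M. (\<Sum>t\<le>m. \<Sum>t'\<le>m. of_real (a t * a t') * (z j ^ t * cnj (z j ^ t'))))"
    unfolding of_real_sum complex_norm_square cnj_sum sum_product
    by (intro sum.cong refl) simp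
  also have "\<dots> = (\<Sum>t\<le>m. \<Sum>t'\<le>m. \<Sum>j<M. of_real (a t * a t') * (z j ^ t * cnj (z j ^ t')))"
    by (rule trans[OF sum.swap], rule sum.cong[OF refl], rule sum.swap)
  also have "\<dots> = (\<Sum>t\<le>m. \<Sum>t'\<le>m. of_real (a t * a t') * (if t = t' then of_nat M else 0))"
    unfolding sum_distrib_left[symmetric] by (intro sum.cong refl) (simp only: orth atMost_iff)
  also have "\<dots> = complex_of_real (real M * (\<Sum>t\<le>m. (a t)\<^sup>2))"
    by (simp add: if_distrib power2_eq_square sum_distrib_left algebra_simps cong: if_cong)
  finally show ?thesis
    unfolding of_real_eq_iff z_def .
qed

lemma ball_ft_generating_function:
  assumes "u \<subseteq> {..<n}" "u \<noteq> {}"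
  shows "(\<Sum>t\<le>n. of_real (ball_ft n t u) * z ^ t) = (1 - z) ^ (card u - 1) * (1 + z :: complex) ^ (n - card u)"
proof -
  define Q :: "complex poly" where "Q = [:1, -1:] ^ (card u - 1) * [:1, 1:] ^ (n - card u)"
  have "card u \<le> n" using card_mono[of "{..<n}" u] assms by simp
  have "degree Q \<le> degree ([:1, -1 :: complex:] ^ (card u - 1)) + degree ([:1, 1 :: complex:] ^ (n - card u))"
    unfolding Q_def by (rule degree_mult_le)
  also have "\<dots> \<le> n"
    using \<open>card u \<le> n\<close> by (simp add: degree_power_eq)
  finally have "poly Q z = (\<Sum>t\<le>n. coeff Q t * z ^ t)"
    using arg_cong[OF poly_as_sum_of_monoms'[of Q n], of "\<lambda>p. poly p z"] by (simp add: poly_sum poly_monom)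
  then show ?thesis
    unfolding Q_def coeff_eq_ball_ft[OF assms] by simp
qed

text \<open>Parseval over the roots of \<open>z\<^sup>M = -1\<close> with \<open>M\<close> even, which avoids \<open>z = \<plusminus>1\<close>;
  averaging over \<open>z\<close> and \<open>-z\<close> symmetrises the result under
  \<open>card u \<mapsto> n + 1 - card u\<close>.\<close>

lemma sum_ball_ft_square:
  obtains M :: nat and c \<rho> :: "nat \<Rightarrow> real" where "\<And>j. c j \<ge> 0" "\<And>j. \<rho> j > 0"
    "\<And>u. u \<subseteq> {..<n} \<Longrightarrow> u \<noteq> {} \<Longrightarrow>
       (\<Sum>t\<le>n. (ball_ft n t u)\<^sup>2) = (\<Sum>j<M. c j * (\<rho> j ^ card u + \<rho> j ^ (n + 1 - card u)))"
proof -
  define M where "M = 2 * (n + 1)"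
  then have "M > 0" by simp
  define z where "z j = cis (pi * (2 * real j + 1) / real M)" for j
  have "z j ^ M = -1" for j
  proof -
    have "z j ^ M = cis (2 * pi * of_int (int j) + pi)"
      unfolding z_def DeMoivre by (intro arg_cong[of _ _ cis]) (use \<open>M > 0\<close> in \<open>simp add: field_simps\<close>)
    then show ?thesis
      by (simp only: cis_mult[symmetric] cis_multiple_2pi Ints_of_int cis_pi) simp
  qed
  moreover have "1 ^ M = (1 :: complex)" "(-1) ^ M = (1 :: complex)" by (simp_all add: M_def)
  ultimately have z: "z j \<noteq> 1" "z j \<noteq> -1" for j
    by (metis one_neq_neg_one)+
  define a b where "a j = (cmod (1 - z j))\<^sup>2" and "b j = (cmod (1 + z j))\<^sup>2" for j
  have pos: "a j > 0" "b j > 0" for j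
    using z[of j] by (auto simp: a_def b_def add_eq_0_iff)
  show ?thesis
  \<comment> \<open>With \<open>k = card u\<close>, Parseval at \<open>z j\<close> and at
    \<open>- z j\<close> yields \<open>a ^ (k - 1) * b ^ (n - k)\<close> and the same with
    \<open>a\<close> and \<open>b\<close> exchanged. Factoring \<open>b ^ n / a\<close> out of both
    leaves the powers \<open>k\<close> and \<open>n + 1 - k\<close> of \<open>a / b\<close>; the 2
    comes from averaging.\<close>
  proof (rule that[of "\<lambda>j. b j ^ n / (2 * real M * a j)" "\<lambda>j. a j / b j" M])
    fix u assume u: "u \<subseteq> {..<n}" "u \<noteq> {}"
    define k where "k = card u"
    have "finite u" using u finite_subset by blast
    then have k: "k > 0" "k \<le> n"
      using u card_mono[of "{..<n}" u] by (simp_all add: card_gt_0_iff k_def)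
    have 1: "(\<Sum>j<M. a j ^ (k - 1) * b j ^ (n - k)) = real M * (\<Sum>t\<le>n. (ball_ft n t u)\<^sup>2)"
      using parseval_roots_of_unity[of n M "\<lambda>t. ball_ft n t u"]
      unfolding ball_ft_generating_function[OF u]
      by (simp add: M_def k_def a_def b_def z_def norm_mult norm_power power_mult_distrib
          power_mult[symmetric] mult.commute[of 2])
    have "(\<Sum>t\<le>n. of_real ((-1) ^ t * ball_ft n t u) * z j ^ t) = (1 + z j) ^ (k - 1) * (1 - z j) ^ (n - k)" for j
      using ball_ft_generating_function[OF u, of "- z j"]
      by (simp add: power_minus[of "z j"] algebra_simps k_def)
    then have 2: "(\<Sum>j<M. b j ^ (k - 1) * a j ^ (n - k)) = real M * (\<Sum>t\<le>n. (ball_ft n t u)\<^sup>2)"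
      using parseval_roots_of_unity[of n M "\<lambda>t. (-1) ^ t * ball_ft n t u"]
      by (simp add: M_def a_def b_def z_def norm_mult norm_power power_mult_distrib
          power_mult[symmetric] mult.commute[of 2])
    have "b j ^ n / (2 * real M * a j) * ((a j / b j) ^ k + (a j / b j) ^ (n + 1 - k))
        = (a j ^ (k - 1) * b j ^ (n - k) + b j ^ (k - 1) * a j ^ (n - k)) / (2 * real M)" for j
    proof -
      obtain l where l: "k = Suc l" using k(1) by (cases k) auto
      obtain r where r: "n = k + r" using k(2) le_Suc_ex by blast
      show ?thesis using pos[of j] \<open>M > 0\<close>
        by (simp add: l r field_simps power_add)
    qed
    then have "(\<Sum>j<M. b j ^ n / (2 * real M * a j) * ((a j / b j) ^ k + (a j / b j) ^ (n + 1 - k)))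
        = ((\<Sum>j<M. a j ^ (k - 1) * b j ^ (n - k)) + (\<Sum>j<M. b j ^ (k - 1) * a j ^ (n - k))) / (2 * real M)"
      by (simp add: sum.distrib flip: sum_divide_distrib)
    also have "\<dots> = (\<Sum>t\<le>n. (ball_ft n t u)\<^sup>2)"
      unfolding 1 2 by (simp add: M_def field_simps)
    finally show "(\<Sum>t\<le>n. (ball_ft n t u)\<^sup>2)
        = (\<Sum>j<M. b j ^ n / (2 * real M * a j) * ((a j / b j) ^ card u + (a j / b j) ^ (n + 1 - card u)))"
      by (simp add: k_def)
  qed (use pos in \<open>auto simp: less_imp_le\<close>)
qed

section \<open>Energy comparison\<close>

text \<open>The term at the empty word depends only on the size of the code, so codes of equal size
  are compared by the values of \<open>F\<close> at nonempty words.\<close>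

lemma energy_eq_off_empty:
  assumes "Z \<subseteq> Pow {..<n}"
  shows "energy n Z F = (real (card Z))\<^sup>2 * F {} + (\<Sum>u\<in>Pow {..<n} - {{}}. (\<Sum>z\<in>Z. chi u z)\<^sup>2 * F u)"
  unfolding energy_def by (subst sum.remove[of _ "{}"]) auto

lemma energy_scale: "energy n Z (\<lambda>u. c * F u) = c * energy n Z F"
  unfolding energy_def by (simp add: sum_distrib_left mult_ac)

lemma energy_sum: "energy n Z (\<lambda>u. \<Sum>i\<in>I. F i u) = (\<Sum>i\<in>I. energy n Z (F i))"
  unfolding energy_def sum_distrib_left by (rule sum.swap)

lemma energy_le_cong:
  assumes "Z \<subseteq> Pow {..<n}" "Z' \<subseteq> Pow {..<n}" "card Z' = card Z"
    and "\<And>u. u \<subseteq> {..<n} \<Longrightarrow> u \<noteq> {} \<Longrightarrow> F u = G u"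
    and "energy n Z F \<le> energy n Z' F"
  shows "energy n Z G \<le> energy n Z' G"
proof -
  have "(\<Sum>u\<in>Pow {..<n} - {{}}. (\<Sum>z\<in>Y. chi u z)\<^sup>2 * F u) = (\<Sum>u\<in>Pow {..<n} - {{}}. (\<Sum>z\<in>Y. chi u z)\<^sup>2 * G u)" for Y
    using assms(4) by (intro sum.cong) auto
  with assms(5) show ?thesis
    by (simp add: energy_eq_off_empty assms(1-3))
qed

text \<open>Off the empty word, \<open>F\<close> may be replaced by \<open>H\<close> for
  \<open>Z\<close> by tightness; the energy of \<open>H\<close> does not decrease from
  \<open>Z\<close> to \<open>Z'\<close>, and \<open>H\<close> is below \<open>F\<close> for
  \<open>Z'\<close>.\<close>

lemma energy_le_of_minorant:
  assumes Z: "Z \<subseteq> Pow {..<n}" "Z' \<subseteq> Pow {..<n}" "card Z' = card Z"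
    and sep: "\<And>z z'. z \<in> Z \<Longrightarrow> z' \<in> Z \<Longrightarrow> z \<noteq> z' \<Longrightarrow> d < card (sdiff z z')"
    and H: "pos_band_limited n d H"
    and le: "\<And>u. u \<subseteq> {..<n} \<Longrightarrow> u \<noteq> {} \<Longrightarrow> H u \<le> F u"
    and eq: "\<And>u. u \<subseteq> {..<n} \<Longrightarrow> u \<noteq> {} \<Longrightarrow> (\<Sum>z\<in>Z. chi u z) \<noteq> 0 \<Longrightarrow> H u = F u"
  shows "energy n Z F \<le> energy n Z' F"
proof -
  have "(\<Sum>u\<in>Pow {..<n} - {{}}. (\<Sum>z\<in>Z. chi u z)\<^sup>2 * F u) = (\<Sum>u\<in>Pow {..<n} - {{}}. (\<Sum>z\<in>Z. chi u z)\<^sup>2 * H u)"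
  proof (rule sum.cong[OF refl])
    fix u assume "u \<in> Pow {..<n} - {{}}"
    then show "(\<Sum>z\<in>Z. chi u z)\<^sup>2 * F u = (\<Sum>z\<in>Z. chi u z)\<^sup>2 * H u"
      using eq[of u] by (cases "(\<Sum>z\<in>Z. chi u z) = 0") simp_all
  qed
  moreover have "(\<Sum>u\<in>Pow {..<n} - {{}}. (\<Sum>z\<in>Z'. chi u z)\<^sup>2 * H u) \<le> (\<Sum>u\<in>Pow {..<n} - {{}}. (\<Sum>z\<in>Z'. chi u z)\<^sup>2 * F u)"
    using le by (intro sum_mono mult_left_mono) auto
  moreover have "energy n Z H \<le> energy n Z' H"
    by (rule energy_pos_band_limited_le[OF Z sep H])
  ultimately show ?thesis
    by (simp add: energy_eq_off_empty Z)
qed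

lemma chi_mult_ft:
  assumes "u \<subseteq> {..<n}" "a < n"
  shows "chi u {a} * ft n p u = ft n (\<lambda>v. p (sdiff {a} v)) u"
proof -
  have "finite u" using assms finite_subset by blast
  then have "chi u {a} * ft n p u = (\<Sum>v\<in>Pow {..<n}. p (sdiff {a} (sdiff {a} v)) * chi u (sdiff {a} v))"
    unfolding ft_def sum_distrib_left by (intro sum.cong) (simp_all add: chi_sdiff)
  also have "\<dots> = ft n (\<lambda>v. p (sdiff {a} v)) u"
    unfolding ft_def using assms sum_Pow_sdiff[of "{a}" "{..<n}" "\<lambda>v. p (sdiff {a} v) * chi u v"] by simp
  finally show ?thesis .
qed

text \<open>Writing \<open>card u\<close> through characters of single coordinates turns the sum, by
  Parseval, into differences of the ball indicator at \<open>v\<close> and at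
  \<open>sdiff {a} v\<close>. Where \<open>q\<close> is nonzero, \<open>card v < i\<close>, so both
  words lie in the ball and the difference is 0.\<close>

lemma sum_card_ball_ft_orthogonal:
  assumes "band_limited n d G" "d < i"
  shows "(\<Sum>u\<in>Pow {..<n}. real (card u) * ball_ft n i u * G u) = 0"
proof -
  obtain q where q: "\<forall>v\<in>Pow {..<n}. q v \<noteq> 0 \<longrightarrow> card v \<le> d" "\<forall>u\<in>Pow {..<n}. G u = ft n q u"
    using assms(1) unfolding band_limited_def by blast
  define b :: "nat set \<Rightarrow> real" where "b v = (if card v \<le> i then 1 else 0)" for v
  have "(\<Sum>u\<in>Pow {..<n}. real (card u) * ball_ft n i u * G u)
      = (\<Sum>u\<in>Pow {..<n}. \<Sum>a<n. (ft n b u * ft n q u - ft n (\<lambda>v. b (sdiff {a} v)) u * ft n q u) / 2)"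
  proof (rule sum.cong[OF refl])
    fix u assume "u \<in> Pow {..<n}"
    then have u: "u \<subseteq> {..<n}" by simp
    have "ball_ft n i u = ft n b u" by (simp add: ball_ft_def b_def[abs_def])
    then show "real (card u) * ball_ft n i u * G u
        = (\<Sum>a<n. (ft n b u * ft n q u - ft n (\<lambda>v. b (sdiff {a} v)) u * ft n q u) / 2)"
      using q(2) u unfolding card_eq_sum_chi[OF u] sum_distrib_right
      by (intro sum.cong refl) (simp add: chi_mult_ft[OF u, symmetric] algebra_simps)
  qed
  also have "\<dots> = (\<Sum>a<n. ((\<Sum>u\<in>Pow {..<n}. ft n b u * ft n q u)
      - (\<Sum>u\<in>Pow {..<n}. ft n (\<lambda>v. b (sdiff {a} v)) u * ft n q u)) / 2)"
    by (rule trans[OF sum.swap]) (simp add: sum_subtractf flip: sum_divide_distrib)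
  also have "\<dots> = 0"
  proof (rule sum.neutral, rule ballI)
    fix a assume a: "a \<in> {..<n}"
    have "b v * q v = b (sdiff {a} v) * q v" if "v \<in> Pow {..<n}" for v
    proof (cases "q v = 0")
      case False
      then have "card v < i" using q(1) that assms(2) by force
      moreover have "card (sdiff {a} v) \<le> 1 + card v"
        using card_sdiff_le[of "{a}" v] that finite_subset by auto
      ultimately show ?thesis by (simp add: b_def)
    qed simp
    then have "(\<Sum>v\<in>Pow {..<n}. b v * q v) = (\<Sum>v\<in>Pow {..<n}. b (sdiff {a} v) * q v)"
      by (rule sum.cong[OF refl])
    then show "((\<Sum>u\<in>Pow {..<n}. ft n b u * ft n q u)
      - (\<Sum>u\<in>Pow {..<n}. ft n (\<lambda>v. b (sdiff {a} v)) u * ft n q u)) / 2 = 0"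
      unfolding sum_ft_mult by simp
  qed
  finally show ?thesis .
qed

section \<open>Separation and dual weights of perfect codes\<close>

lemma perfect_separation:
  fixes n :: nat
  assumes "z \<in> Z" "z' \<in> Z" "z \<noteq> z'" "Z \<subseteq> Pow {..<n}"
    and "\<And>x. x \<subseteq> {..<n} \<Longrightarrow> \<exists>!z. z \<in> Z \<and> card (sdiff x z) \<le> e"
  shows "2 * e < card (sdiff z z')"
proof (rule ccontr)
  assume "\<not> 2 * e < card (sdiff z z')"
  moreover have sub: "sdiff z z' \<subseteq> {..<n}" "z \<subseteq> {..<n}" using assms(1,2,4) by (auto simp: sdiff_def)
  \<comment> \<open>Flipping the coordinates in \<open>a\<close> moves \<open>z\<close> towards
    \<open>z'\<close> to a word within \<open>e\<close> of both; the minimum covers distances below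
    \<open>e\<close>.\<close>
  moreover obtain a where a: "a \<subseteq> sdiff z z'" "card a = min e (card (sdiff z z'))"
    using obtain_subset_with_card_n[of "min e (card (sdiff z z'))" "sdiff z z'"] by auto
  moreover have "finite a" using finite_subset[OF a(1) finite_subset[OF sub(1)]] by simp
  ultimately have "card (sdiff z z' - a) \<le> e" "card a \<le> e"
    using card_Diff_subset[of a "sdiff z z'"] by simp_all
  moreover have "sdiff (sdiff z a) z' = sdiff z z' - a" "sdiff (sdiff z a) z = a"
    using a(1) by (auto simp: sdiff_def)
  moreover have "sdiff z a \<subseteq> {..<n}" using a(1) sub by (auto simp: sdiff_def)
  ultimately show False
    using assms(5)[of "sdiff z a"] assms(1-3) by metis
qed

text \<open>The balls around the codewords partition the cube, so the code convolved with the ball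
  is constant and its transform, the product, vanishes at nonempty words.\<close>

lemma perfect_dual_weights:
  assumes Z: "Z \<subseteq> Pow {..<n}" and perfect: "\<And>x. x \<subseteq> {..<n} \<Longrightarrow> \<exists>!z. z \<in> Z \<and> card (sdiff x z) \<le> e"
    and u: "u \<subseteq> {..<n}" "u \<noteq> {}"
  shows "(\<Sum>z\<in>Z. chi u z) * ball_ft n e u = 0"
proof -
  have fin: "finite Z" "finite u" using Z u finite_subset by blast+
  have "0 = (\<Sum>x\<in>Pow {..<n}. chi u x)"
    using sum_chi[OF u(1)] u(2) by (simp add: chi_commute[of u])
  also have "\<dots> = (\<Sum>x\<in>Pow {..<n}. \<Sum>z\<in>Z. if card (sdiff z x) \<le> e then chi u x else 0)"
  proof (rule sum.cong[OF refl])
    fix x assume "x \<in> Pow {..<n}"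
    then have "\<exists>!z. z \<in> Z \<and> card (sdiff x z) \<le> e" using perfect by simp
    then obtain y where y: "y \<in> Z" "card (sdiff x y) \<le> e" "\<And>z. z \<in> Z \<Longrightarrow> card (sdiff x z) \<le> e \<Longrightarrow> z = y"
      by (rule ex1E) blast
    have "card (sdiff z x) \<le> e \<longleftrightarrow> z = y" if "z \<in> Z" for z
      using y that sdiff_commute[of z x] by metis
    then have "(\<Sum>z\<in>Z. if card (sdiff z x) \<le> e then chi u x else 0) = (\<Sum>z\<in>Z. if z = y then chi u x else 0)"
      by (intro sum.cong) simp_all
    then show "chi u x = (\<Sum>z\<in>Z. if card (sdiff z x) \<le> e then chi u x else 0)"
      using fin y(1) by simp
  qed
  also have "\<dots> = (\<Sum>z\<in>Z. \<Sum>x\<in>Pow {..<n}. if card (sdiff z x) \<le> e then chi u x else 0)"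
    by (rule sum.swap)
  also have "\<dots> = (\<Sum>z\<in>Z. chi u z * ball_ft n e u)"
  proof (rule sum.cong[OF refl])
    fix z assume "z \<in> Z"
    then have "z \<subseteq> {..<n}" using Z by auto
    then have "(\<Sum>x\<in>Pow {..<n}. if card (sdiff z x) \<le> e then chi u x else 0)
        = (\<Sum>x\<in>Pow {..<n}. if card x \<le> e then chi u (sdiff z x) else 0)"
      using sum_Pow_sdiff[of z "{..<n}" "\<lambda>x. if card x \<le> e then chi u (sdiff z x) else 0"]
      by (simp cong: if_cong)
    also have "\<dots> = chi u z * ball_ft n e u"
      unfolding ball_ft_def ft_def sum_distrib_left
      by (intro sum.cong) (auto simp: chi_sdiff[OF fin(2)])
    finally show "(\<Sum>x\<in>Pow {..<n}. if card (sdiff z x) \<le> e then chi u x else 0) = chi u z * ball_ft n e u" .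
  qed
  finally show ?thesis by (simp add: sum_distrib_right)
qed

text \<open>Eliminate leading terms, since \<open>lloyd_poly n j\<close> has degree exactly
  \<open>j\<close>. The alternative \<open>A = 0\<close> covers \<open>e = 0\<close>.\<close>

lemma poly_span_lloyd:
  assumes "A = 0 \<or> degree A < e"
  obtains \<alpha> where "A = (\<Sum>j<e. smult (\<alpha> j) (lloyd_poly n j))"
proof -
  have "\<exists>\<alpha>. A = (\<Sum>j<e. smult (\<alpha> j) (lloyd_poly n j))"
    using assms
  proof (induction e arbitrary: A)
    case (Suc e)
    define c where "c = coeff A e / lead_coeff (lloyd_poly n e)"
    have L: "degree (lloyd_poly n e) = e" "coeff (lloyd_poly n e) e > 0"
      using degree_lloyd_poly[of n e] by auto
    have "degree (A - smult c (lloyd_poly n e)) \<le> e"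
      using Suc.prems L(1) by (intro degree_diff_le) auto
    moreover have "coeff (A - smult c (lloyd_poly n e)) e = 0"
      using L by (simp add: c_def)
    ultimately have "A - smult c (lloyd_poly n e) = 0 \<or> degree (A - smult c (lloyd_poly n e)) < e"
      using eq_zero_or_degree_less by blast
    then obtain \<alpha> where \<alpha>: "A - smult c (lloyd_poly n e) = (\<Sum>j<e. smult (\<alpha> j) (lloyd_poly n j))"
      using Suc.IH by blast
    have "A = (\<Sum>j<Suc e. smult ((\<alpha>(e := c)) j) (lloyd_poly n j))"
      using \<alpha> by (simp add: algebra_simps)
    then show ?case by blast
  qed auto
  then show ?thesis using that by blast
qed

section \<open>Perfect codes\<close>

text \<open>The assumption \<open>radius\<close> holds once the code has two words, and makes the
  cube supply more than \<open>e\<close> distinct values of the variable.\<close>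

locale binary_perfect_code =
  fixes n e :: nat and Z :: "nat set set"
  assumes Z_subset: "Z \<subseteq> Pow {..<n}"
    and perfect: "\<And>x. x \<subseteq> {..<n} \<Longrightarrow> \<exists>!z. z \<in> Z \<and> card (sdiff x z) \<le> e"
    and radius: "2 * e < n"
begin

definition spectrum :: "nat set set" where
  "spectrum = {u \<in> Pow {..<n}. u \<noteq> {} \<and> (\<Sum>z\<in>Z. chi u z) \<noteq> 0}"

definition node :: "nat set \<Rightarrow> real" where
  "node u = real n + 1 - real (card u)"

definition nodes :: "real set" where
  "nodes = node ` spectrum"

text \<open>The factor \<open>card u\<close> is the one for which the ball transforms are orthogonal
  to lower degrees on the cube.\<close>

definition weight :: "real \<Rightarrow> real" where
  "weight t = (\<Sum>u | u \<in> spectrum \<and> node u = t. (\<Sum>z\<in>Z. chi u z)\<^sup>2 * real (card u))"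

definition node_poly :: "real poly" where
  "node_poly = (\<Prod>t\<in>nodes. [:-t, 1:])"

lemma finite_spectrum: "finite spectrum"
  unfolding spectrum_def by simp

lemma finite_nodes: "finite nodes"
  unfolding nodes_def using finite_spectrum by simp

lemma card_nonempty_word:
  assumes "u \<subseteq> {..<n}" "u \<noteq> {}"
  shows "0 < card u" "card u \<le> n"
  using assms card_mono[of "{..<n}" u] finite_subset[OF assms(1)] by (auto simp: card_gt_0_iff)

lemma nodes_pos:
  assumes "t \<in> nodes" shows "t > 0"
proof -
  obtain u where "u \<subseteq> {..<n}" "t = node u"
    using assms unfolding nodes_def spectrum_def by blast
  then show ?thesis using card_mono[of "{..<n}" u] by (simp add: node_def)
qed

lemma weight_pos: "t \<in> nodes \<Longrightarrow> weight t > 0"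
  unfolding weight_def using finite_spectrum card_nonempty_word(1)
  by (intro sum_pos) (auto simp: nodes_def spectrum_def)

lemma card_Z_pos: "card Z > 0"
proof -
  have "Z \<noteq> {}" using perfect[of "{}"] by auto
  then show ?thesis using Z_subset finite_subset by (auto simp: card_gt_0_iff)
qed

lemma separation: "z \<in> Z \<Longrightarrow> z' \<in> Z \<Longrightarrow> z \<noteq> z' \<Longrightarrow> 2 * e < card (sdiff z z')"
  by (rule perfect_separation[OF _ _ _ Z_subset perfect])

lemma ball_ft_spectrum: "u \<in> spectrum \<Longrightarrow> ball_ft n e u = 0"
  using perfect_dual_weights[OF Z_subset perfect, of u] by (simp add: spectrum_def)

lemma sum_nodes: "(\<Sum>t\<in>nodes. weight t * f t) = energy n Z (\<lambda>u. real (card u) * f (node u))"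
proof -
  have "(\<Sum>t\<in>nodes. weight t * f t)
      = (\<Sum>t\<in>nodes. \<Sum>u | u \<in> spectrum \<and> node u = t. (\<Sum>z\<in>Z. chi u z)\<^sup>2 * (real (card u) * f (node u)))"
    unfolding weight_def sum_distrib_right by (intro sum.cong refl) auto
  also have "\<dots> = (\<Sum>u\<in>spectrum. (\<Sum>z\<in>Z. chi u z)\<^sup>2 * (real (card u) * f (node u)))"
    by (rule sum.group) (use finite_spectrum finite_nodes in \<open>auto simp: nodes_def\<close>)
  also have "\<dots> = energy n Z (\<lambda>u. real (card u) * f (node u))"
    unfolding energy_def by (rule sum.mono_neutral_left) (auto simp: spectrum_def)
  finally show ?thesis .
qed

text \<open>The factor \<open>card u\<close> costs one unit of weight, so degree below
  \<open>2 * e\<close> keeps the summand within band \<open>2 * e\<close>, below the minimum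
  distance.\<close>

lemma quadrature:
  assumes "degree f < 2 * e"
  shows "(\<Sum>t\<in>nodes. weight t * poly f t) = real (card Z) * (\<Sum>u\<in>Pow {..<n}. real (card u) * poly f (node u))"
proof -
  have "band_limited n (2 * e) (\<lambda>u. real (card u) * poly f (node u))"
    using band_limited_mono[OF band_limited_mult[OF band_limited_card band_limited_poly[of n f]], of "2 * e"] assms
    by (simp add: node_def)
  then show ?thesis
    unfolding sum_nodes using energy_band_limited[OF Z_subset separation] by blast
qed

text \<open>Quadrature carries the orthogonality on the whole cube over to the nodes.\<close>

lemma lloyd_orthogonal:
  assumes "i \<le> e"
  shows "orthogonal_to_lower nodes weight i (lloyd_poly n i)"
  unfolding orthogonal_to_lower_def
proof (intro allI impI)
  fix q :: "real poly" assume q: "degree q < i"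
  have "degree (lloyd_poly n i * q) < 2 * e"
    using degree_mult_le[of "lloyd_poly n i" q] degree_lloyd_poly[of n i] assms q by linarith
  then have "(\<Sum>t\<in>nodes. weight t * poly (lloyd_poly n i * q) t)
      = real (card Z) * (\<Sum>u\<in>Pow {..<n}. real (card u) * poly (lloyd_poly n i * q) (node u))"
    by (rule quadrature)
  also have "(\<Sum>u\<in>Pow {..<n}. real (card u) * poly (lloyd_poly n i * q) (node u))
      = (\<Sum>u\<in>Pow {..<n}. real (card u) * ball_ft n i u * poly q (real n + 1 - real (card u)))"
  proof (rule sum.cong[OF refl])
    fix u assume "u \<in> Pow {..<n}"
    then show "real (card u) * poly (lloyd_poly n i * q) (node u)
        = real (card u) * ball_ft n i u * poly q (real n + 1 - real (card u))"
      \<comment> \<open>At the empty word the factor \<open>card u\<close> makes both sides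
        0.\<close>
      using poly_lloyd_poly[of u n i] by (cases "u = {}") (auto simp: node_def)
  qed
  also have "\<dots> = 0"
    by (rule sum_card_ball_ft_orthogonal[OF band_limited_poly q])
  finally show "(\<Sum>t\<in>nodes. weight t * poly (lloyd_poly n i) t * poly q t) = 0"
    by (simp add: mult.assoc)
qed

text \<open>By quadrature, norm 0 would force \<open>f\<close> to vanish at the integers from 1 to
  \<open>n\<close>, more than its degree allows.\<close>

lemma norm_pos:
  assumes "f \<noteq> 0" "degree f < e"
  shows "(\<Sum>t\<in>nodes. weight t * poly f t * poly f t) > 0"
proof -
  have nonneg: "(\<Sum>u\<in>Pow {..<n}. real (card u) * poly (f * f) (node u)) \<ge> 0"
    by (intro sum_nonneg) auto
  have "(\<Sum>u\<in>Pow {..<n}. real (card u) * poly (f * f) (node u)) \<noteq> 0"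
  proof
    assume "(\<Sum>u\<in>Pow {..<n}. real (card u) * poly (f * f) (node u)) = 0"
    then have *: "\<forall>u\<in>Pow {..<n}. real (card u) * poly (f * f) (node u) = 0"
      by (subst (asm) sum_nonneg_eq_0_iff) auto
    have "poly f (real k) = 0" if "k \<in> {1..n}" for k
    proof -
      \<comment> \<open>An initial segment of this size is a word whose node is
        \<open>k\<close>.\<close>
      have "real (card {..<n + 1 - k}) * poly (f * f) (node {..<n + 1 - k}) = 0"
        using * that by (intro bspec[OF *]) auto
      then show ?thesis using that by (auto simp: node_def of_nat_diff)
    qed
    then have "real ` {1..n} \<subseteq> {x. poly f x = 0}" by auto
    then have "card (real ` {1..n}) \<le> card {x. poly f x = 0}"
      using poly_roots_finite[OF assms(1)] by (intro card_mono)
    also have "\<dots> \<le> degree f" by (rule card_poly_roots_bound[OF assms(1)])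
    finally have "n \<le> degree f" by (simp add: card_image inj_on_def)
    with assms(2) radius show False by simp
  qed
  with nonneg have "(\<Sum>u\<in>Pow {..<n}. real (card u) * poly (f * f) (node u)) > 0" by simp
  moreover have "degree (f * f) < 2 * e"
    using degree_mult_le[of f f] assms(2) by linarith
  ultimately have "(\<Sum>t\<in>nodes. weight t * poly (f * f) t) > 0"
    using card_Z_pos by (simp only: quadrature) simp
  then show ?thesis by (simp add: mult.assoc)
qed

lemma degree_node_poly: "degree node_poly = card nodes" "lead_coeff node_poly = 1"
proof -
  show "degree node_poly = card nodes"
    unfolding node_poly_def by (subst degree_prod_eq_sum_degree) auto
  show "lead_coeff node_poly = 1"
    unfolding node_poly_def by (simp add: lead_coeff_prod)
qed

lemma poly_node_poly_nodes: "t \<in> nodes \<Longrightarrow> poly node_poly t = 0"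
  unfolding node_poly_def poly_prod using finite_nodes by auto

lemma lloyd_nodes:
  assumes "t \<in> nodes" shows "poly (lloyd_poly n e) t = 0"
proof -
  obtain u where u: "u \<in> spectrum" "t = node u" using assms unfolding nodes_def by blast
  then have "poly (lloyd_poly n e) t = ball_ft n e u"
    using poly_lloyd_poly[of u n e] by (simp add: spectrum_def node_def)
  then show ?thesis using ball_ft_spectrum[OF u(1)] by simp
qed

lemma lloyd_nonzero: "lloyd_poly n j \<noteq> 0"
  using degree_lloyd_poly[of n j] by auto

text \<open>All nodes are roots of the Lloyd polynomial, so there are at most \<open>e\<close>. With
  fewer, \<open>node_poly\<close> would have degree below \<open>e\<close> and norm 0.\<close>

lemma card_nodes: "card nodes = e"
proof (rule antisym)
  have "card nodes \<le> card {x. poly (lloyd_poly n e) x = 0}"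
    using poly_roots_finite[OF lloyd_nonzero] lloyd_nodes by (intro card_mono) auto
  also have "\<dots> \<le> e"
    using card_poly_roots_bound[OF lloyd_nonzero[of e]] degree_lloyd_poly[of n e] by simp
  finally show "card nodes \<le> e" .
  show "e \<le> card nodes"
  proof (rule ccontr)
    assume "\<not> e \<le> card nodes"
    then have "(\<Sum>t\<in>nodes. weight t * poly node_poly t * poly node_poly t) > 0"
      using degree_node_poly by (intro norm_pos) auto
    then show False by (simp add: poly_node_poly_nodes)
  qed
qed

lemma lloyd_eq_node_poly: "lloyd_poly n e = smult (lead_coeff (lloyd_poly n e)) node_poly"
proof (rule ccontr)
  let ?r = "lloyd_poly n e - smult (lead_coeff (lloyd_poly n e)) node_poly"
  assume "lloyd_poly n e \<noteq> smult (lead_coeff (lloyd_poly n e)) node_poly"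
  then have r: "?r \<noteq> 0" by simp
  have d: "degree (lloyd_poly n e) = e" "degree node_poly = e" "coeff node_poly e = 1"
    using degree_lloyd_poly[of n e] degree_node_poly card_nodes by auto
  have "degree ?r \<le> e"
    using d by (intro degree_diff_le) auto
  moreover have "coeff ?r e = 0" using d by simp
  ultimately have "degree ?r < e" using r eq_zero_or_degree_less by blast
  moreover have "card nodes \<le> card {x. poly ?r x = 0}"
    using poly_roots_finite[OF r] lloyd_nodes poly_node_poly_nodes by (intro card_mono) auto
  moreover have "card {x. poly ?r x = 0} \<le> degree ?r"
    by (rule card_poly_roots_bound[OF r])
  ultimately show False using card_nodes by simp
qed

text \<open>As \<open>f\<close> and its remainder agree on the nodes, each coefficient is the inner
  product of \<open>f\<close> with \<open>lloyd_poly n j\<close> divided by a positive norm;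
  \<open>nonneg_coeffs_inner_orthogonal\<close> gives its sign.\<close>

lemma newton_lloyd:
  assumes "nonneg_coeffs f"
  obtains \<alpha> g where "\<And>j. j < e \<Longrightarrow> \<alpha> j \<ge> 0" "nonneg_coeffs g"
    "f = (\<Sum>j<e. smult (\<alpha> j) (lloyd_poly n j)) + node_poly * g"
proof -
  obtain A g where Ag: "f = A + node_poly * g" "nonneg_coeffs g" "A = 0 \<or> degree A < card nodes"
    using newton_remainder[OF finite_nodes nodes_pos assms] unfolding node_poly_def by blast
  obtain \<alpha> where \<alpha>: "A = (\<Sum>j<e. smult (\<alpha> j) (lloyd_poly n j))"
    using poly_span_lloyd[of A e n] Ag(3) card_nodes by auto
  have "\<alpha> j \<ge> 0" if j: "j < e" for j
  proof -
    have L: "degree (lloyd_poly n j) = j" "lead_coeff (lloyd_poly n j) \<ge> 0"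
      using degree_lloyd_poly[of n j] by auto
    have ortho: "(\<Sum>t\<in>nodes. weight t * poly (lloyd_poly n i) t * poly (lloyd_poly n j) t) = 0"
      if "i < e" "i \<noteq> j" for i
    proof (cases "i < j")
      case True
      then show ?thesis
        using lloyd_orthogonal[of j] j degree_lloyd_poly[of n i]
        by (simp add: orthogonal_to_lower_def mult.assoc mult.commute[of "poly (lloyd_poly n i) _"])
    next
      case False
      then show ?thesis
        using lloyd_orthogonal[of i] that L
        by (auto simp: orthogonal_to_lower_def)
    qed
    have "0 \<le> (\<Sum>t\<in>nodes. weight t * poly f t * poly (lloyd_poly n j) t)"
      using nonneg_coeffs_inner_orthogonal[OF finite_nodes nodes_pos weight_pos assms L lloyd_orthogonal] j
      by simp
    also have "\<dots> = (\<Sum>t\<in>nodes. weight t * poly A t * poly (lloyd_poly n j) t)"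
      by (intro sum.cong) (simp_all add: Ag(1) poly_node_poly_nodes)
    also have "\<dots> = (\<Sum>t\<in>nodes. \<Sum>i<e. \<alpha> i * (weight t * poly (lloyd_poly n i) t * poly (lloyd_poly n j) t))"
      unfolding \<alpha> poly_sum sum_distrib_left sum_distrib_right
      by (intro sum.cong refl) (simp add: mult_ac)
    also have "\<dots> = (\<Sum>i<e. \<alpha> i * (\<Sum>t\<in>nodes. weight t * poly (lloyd_poly n i) t * poly (lloyd_poly n j) t))"
      unfolding sum_distrib_left by (rule sum.swap)
    also have "\<dots> = (\<Sum>i<e. if i = j then \<alpha> j * (\<Sum>t\<in>nodes. weight t * poly (lloyd_poly n j) t * poly (lloyd_poly n j) t) else 0)"
      by (intro sum.cong) (auto simp: ortho)
    also have "\<dots> = \<alpha> j * (\<Sum>t\<in>nodes. weight t * poly (lloyd_poly n j) t * poly (lloyd_poly n j) t)"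
      using j by simp
    finally show ?thesis
      using norm_pos[OF lloyd_nonzero[of j]] L(1) j by (simp add: zero_le_mult_iff)
  qed
  then show ?thesis
    using that[of \<alpha> g, OF _ Ag(2) Ag(1)[unfolded \<alpha>]] by simp
qed

lemma energy_power_le:
  assumes Z': "Z' \<subseteq> Pow {..<n}" "card Z' = card Z"
  shows "energy n Z (\<lambda>u. node u ^ m + real (card u) ^ m) \<le> energy n Z' (\<lambda>u. node u ^ m + real (card u) ^ m)"
proof -
  have "nonneg_coeffs (monom 1 m)" by (simp add: nonneg_coeffs_def)
  then obtain \<alpha> f1 where \<alpha>: "\<And>j. j < e \<Longrightarrow> \<alpha> j \<ge> 0" "nonneg_coeffs f1"
    "monom 1 m = (\<Sum>j<e. smult (\<alpha> j) (lloyd_poly n j)) + node_poly * f1"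
    using newton_lloyd by blast
  \<comment> \<open>Interpolating the quotient again makes the final remainder a multiple of the
    square of \<open>node_poly\<close>, hence nonnegative on both sides of every node.\<close>
  obtain \<gamma> g where \<gamma>: "\<And>j. j < e \<Longrightarrow> \<gamma> j \<ge> 0" "nonneg_coeffs g"
    "f1 = (\<Sum>j<e. smult (\<gamma> j) (lloyd_poly n j)) + node_poly * g"
    using newton_lloyd[OF \<alpha>(2)] by blast
  define c where "c = lead_coeff (lloyd_poly n e)"
  have c: "c > 0" "lloyd_poly n e = smult c node_poly"
    using degree_lloyd_poly[of n e] lloyd_eq_node_poly by (auto simp: c_def)
  \<comment> \<open>The two interpolation parts evaluated at \<open>node u\<close> and at
    \<open>card u\<close> and added. Reflection multiplies the term of index \<open>j\<close> by
    \<open>(-1) ^ j\<close> or \<open>(-1) ^ (e + j)\<close>, so only even terms remain, doubled;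
    \<open>c\<close> rescales \<open>node_poly\<close> to the Lloyd polynomial.\<close>
  define H where "H u = (\<Sum>j<e. \<alpha> j * (1 + (-1) ^ j) * ball_ft n j u)
    + (\<Sum>j<e. \<gamma> j * (1 + (-1) ^ (e + j)) / c * (ball_ft n e u * ball_ft n j u))" for u
  have sign: "1 + (-1) ^ k \<ge> (0 :: real)" for k :: nat
    by (cases "even k") auto
  have H: "pos_band_limited n (2 * e) H"
    unfolding H_def
  proof (intro pos_band_limited_add pos_band_limited_sum pos_band_limited_scale)
    fix j assume j: "j \<in> {..<e}"
    show "pos_band_limited n (2 * e) (ball_ft n j)"
      using pos_band_limited_mono[OF pos_band_limited_ball_ft[of n j]] j by simp
    show "pos_band_limited n (2 * e) (\<lambda>u. ball_ft n e u * ball_ft n j u)"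
      using pos_band_limited_mono[OF pos_band_limited_mult[OF pos_band_limited_ball_ft[of n e] pos_band_limited_ball_ft[of n j]]] j
      by simp
    show "0 \<le> \<alpha> j * (1 + (-1) ^ j)" "0 \<le> \<gamma> j * (1 + (-1) ^ (e + j)) / c"
      using \<alpha>(1) \<gamma>(1) c(1) sign j by auto
  qed
  have power_eq: "x ^ m = (\<Sum>j<e. \<alpha> j * poly (lloyd_poly n j) x)
      + (\<Sum>j<e. \<gamma> j / c * (poly (lloyd_poly n e) x * poly (lloyd_poly n j) x))
      + (poly (lloyd_poly n e) x / c)\<^sup>2 * poly g x" for x
  proof -
    have q: "poly node_poly x = poly (lloyd_poly n e) x / c"
      unfolding c(2) using c(1) by simp
    have "x ^ m = poly (monom 1 m) x" by (simp add: poly_monom)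
    also have "\<dots> = (\<Sum>j<e. \<alpha> j * poly (lloyd_poly n j) x)
        + poly node_poly x * ((\<Sum>j<e. \<gamma> j * poly (lloyd_poly n j) x) + poly node_poly x * poly g x)"
      unfolding \<alpha>(3) \<gamma>(3) by (simp add: poly_sum)
    also have "\<dots> = (\<Sum>j<e. \<alpha> j * poly (lloyd_poly n j) x)
      + (\<Sum>j<e. \<gamma> j / c * (poly (lloyd_poly n e) x * poly (lloyd_poly n j) x))
      + (poly (lloyd_poly n e) x / c)\<^sup>2 * poly g x"
      unfolding q by (simp add: sum_distrib_left algebra_simps power2_eq_square)
    finally show ?thesis .
  qed
  have F_eq: "node u ^ m + real (card u) ^ m
      = H u + (ball_ft n e u / c)\<^sup>2 * (poly g (node u) + poly g (real (card u)))"
    if u: "u \<subseteq> {..<n}" "u \<noteq> {}" for u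
  proof -
    have L: "poly (lloyd_poly n j) (node u) = ball_ft n j u" for j
      using poly_lloyd_poly[OF u] by (simp add: node_def)
    have "poly (lloyd_poly n j) (real (card u)) = (-1) ^ j * ball_ft n j u" for j
      using lloyd_poly_reflect[of n j "node u"] L by (simp add: node_def)
    note L = L this
    have sq: "((-1) ^ e * ball_ft n e u / c)\<^sup>2 = (ball_ft n e u / c)\<^sup>2"
      by (simp add: power_mult_distrib power_divide flip: power_mult)
    show ?thesis
      unfolding power_eq[of "node u"] power_eq[of "real (card u)"] L sq H_def
      by (simp add: algebra_simps sum.distrib power_add add_divide_distrib)
  qed
  show ?thesis
  proof (rule energy_le_of_minorant[OF Z_subset Z' separation H])
    fix u assume u: "u \<subseteq> {..<n}" "u \<noteq> {}"
    have "node u \<ge> 0" using card_nonempty_word(2)[OF u] by (simp add: node_def)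
    then have "0 \<le> (ball_ft n e u / c)\<^sup>2 * (poly g (node u) + poly g (real (card u)))"
      using poly_nonneg_coeffs[OF \<gamma>(2)] by (intro mult_nonneg_nonneg) auto
    then show "H u \<le> node u ^ m + real (card u) ^ m"
      using F_eq[OF u] by simp
    assume "(\<Sum>z\<in>Z. chi u z) \<noteq> 0"
    then have "ball_ft n e u = 0"
      using u by (intro ball_ft_spectrum) (simp add: spectrum_def)
    then show "H u = node u ^ m + real (card u) ^ m"
      using F_eq[OF u] by simp
  qed
qed

section \<open>From powers to exponentials and to the ball transforms\<close>

lemma energy_exp_sums:
  "(\<lambda>m. \<beta> ^ m / fact m * energy n Y (\<lambda>u. node u ^ m + real (card u) ^ m))
     sums energy n Y (\<lambda>u. exp (\<beta> * node u) + exp (\<beta> * real (card u)))"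
proof -
  have exp_sums: "(\<lambda>m. \<beta> ^ m / fact m * x ^ m) sums exp (\<beta> * x)" for x :: real
    using exp_converges[of "\<beta> * x"] by (simp add: power_mult_distrib divide_inverse mult_ac)
  have "(\<lambda>m. \<Sum>u\<in>Pow {..<n}. (\<Sum>z\<in>Y. chi u z)\<^sup>2 * (\<beta> ^ m / fact m * node u ^ m + \<beta> ^ m / fact m * real (card u) ^ m))
      sums energy n Y (\<lambda>u. exp (\<beta> * node u) + exp (\<beta> * real (card u)))"
    unfolding energy_def by (intro sums_sum sums_mult sums_add exp_sums)
  then show ?thesis
    unfolding energy_scale[symmetric] by (simp add: energy_def distrib_left)
qed

text \<open>For \<open>\<rho> \<ge> 1\<close> the exponential series is a nonnegative combination of
  powers.\<close>

lemma energy_exponential_le: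
  assumes Z': "Z' \<subseteq> Pow {..<n}" "card Z' = card Z" and "\<rho> > 0"
  shows "energy n Z (\<lambda>u. \<rho> ^ card u + \<rho> ^ (n + 1 - card u)) \<le> energy n Z' (\<lambda>u. \<rho> ^ card u + \<rho> ^ (n + 1 - card u))"
proof -
  have exp_le: "energy n Z (\<lambda>u. exp (\<beta> * node u) + exp (\<beta> * real (card u)))
      \<le> energy n Z' (\<lambda>u. exp (\<beta> * node u) + exp (\<beta> * real (card u)))" if "\<beta> \<ge> 0" for \<beta>
    by (rule sums_le[OF _ energy_exp_sums energy_exp_sums])
       (intro mult_left_mono energy_power_le[OF Z'] divide_nonneg_nonneg zero_le_power that, simp)
  have *: "\<rho> ^ card u = exp (ln \<rho> * real (card u))" "\<rho> ^ (n + 1 - card u) = exp (ln \<rho> * node u)"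
    if "u \<subseteq> {..<n}" for u
  proof -
    have pow: "\<rho> ^ k = exp (ln \<rho> * real k)" for k
      using \<open>\<rho> > 0\<close> by (simp add: exp_of_nat2_mult)
    have "node u = real (n + 1 - card u)"
      using card_mono[OF _ that] by (simp add: node_def of_nat_diff)
    then show "\<rho> ^ card u = exp (ln \<rho> * real (card u))" "\<rho> ^ (n + 1 - card u) = exp (ln \<rho> * node u)"
      by (simp_all only: pow)
  qed
  show ?thesis
  proof (cases "ln \<rho> \<ge> 0")
    case True
    show ?thesis
      by (rule energy_le_cong[OF Z_subset Z' _ exp_le[OF True]]) (simp only: *)
  next
    case False
    \<comment> \<open>For \<open>\<rho> < 1\<close>, factoring out \<open>\<rho> ^ (n + 1)\<close>
      replaces \<open>\<rho>\<close> by its inverse and exchanges the two summands, because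
      \<open>node u\<close> and \<open>card u\<close> add up to \<open>n + 1\<close>.\<close>
    define G where "G u = exp (ln \<rho> * real (n + 1)) * (exp (- ln \<rho> * node u) + exp (- ln \<rho> * real (card u)))" for u
    have G_le: "energy n Z G \<le> energy n Z' G"
      unfolding G_def energy_scale using exp_le[of "- ln \<rho>"] False by (intro mult_left_mono) auto
    have G_eq: "G u = \<rho> ^ card u + \<rho> ^ (n + 1 - card u)" if "u \<subseteq> {..<n}" for u
    proof -
      have "ln \<rho> * real (n + 1) + - ln \<rho> * node u = ln \<rho> * real (card u)"
        "ln \<rho> * real (n + 1) + - ln \<rho> * real (card u) = ln \<rho> * node u"
        by (simp_all add: node_def algebra_simps)
      then show ?thesis
        by (simp only: G_def distrib_left exp_add[symmetric] *[OF that])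
    qed
    show ?thesis
      by (rule energy_le_cong[OF Z_subset Z' G_eq G_le])
  qed
qed

lemma energy_ball_ft_square_le:
  assumes Z': "Z' \<subseteq> Pow {..<n}" "card Z' = card Z"
  shows "energy n Z (\<lambda>u. if u = {} then 0 else \<Sum>t\<le>n. (ball_ft n t u)\<^sup>2)
       \<le> energy n Z' (\<lambda>u. if u = {} then 0 else \<Sum>t\<le>n. (ball_ft n t u)\<^sup>2)"
proof -
  obtain M :: nat and c \<rho> :: "nat \<Rightarrow> real" where pos: "\<And>j. c j \<ge> 0" "\<And>j. \<rho> j > 0"
    and eq: "\<And>u. u \<subseteq> {..<n} \<Longrightarrow> u \<noteq> {} \<Longrightarrow>
       (\<Sum>t\<le>n. (ball_ft n t u)\<^sup>2) = (\<Sum>j<M. c j * (\<rho> j ^ card u + \<rho> j ^ (n + 1 - card u)))"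
    using that by (rule sum_ball_ft_square)
  have "energy n Z (\<lambda>u. \<Sum>j<M. c j * (\<rho> j ^ card u + \<rho> j ^ (n + 1 - card u)))
      \<le> energy n Z' (\<lambda>u. \<Sum>j<M. c j * (\<rho> j ^ card u + \<rho> j ^ (n + 1 - card u)))"
    unfolding energy_sum energy_scale
    by (intro sum_mono mult_left_mono energy_exponential_le Z' pos)
  then show ?thesis
    by (rule energy_le_cong[OF Z_subset Z', rotated]) (simp add: eq)
qed

end

section \<open>Discrepancy\<close>

definition support :: "nat \<Rightarrow> (nat \<Rightarrow> nat) \<Rightarrow> nat set" where
  "support n x = {i. i < n \<and> x i = 1}"

lemma bij_betw_support: "bij_betw (support n) (cube n) (Pow {..<n})"
\<comment> \<open>The inverse is \<open>undefined\<close> outside the coordinate set because words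
  are extensional functions.\<close>
proof (rule bij_betw_byWitness[where f' = "\<lambda>v i. if i < n then if i \<in> v then 1 else 0 else undefined"])
  show "\<forall>x\<in>cube n. (\<lambda>i. if i < n then if i \<in> support n x then 1 else 0 else undefined) = x"
  proof (intro ballI ext)
    fix x i assume x: "x \<in> cube n"
    have "i < n \<Longrightarrow> x i = 0 \<or> x i = 1" "\<not> i < n \<Longrightarrow> x i = undefined"
      using PiE_mem[of x "{..<n}" "\<lambda>_. {0, 1}" i] PiE_arb[of x "{..<n}" "\<lambda>_. {0, 1}" i] x
      unfolding cube_def by simp_all
    then show "(if i < n then if i \<in> support n x then 1 else 0 else undefined) = x i"
      by (auto simp: support_def)
  qed
qed (auto simp: cube_def support_def split: if_splits)

lemma hamming_support:
  assumes "x \<in> cube n" "y \<in> cube n"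
  shows "hamming n x y = card (sdiff (support n x) (support n y))"
proof -
  have "x i \<in> {0, 1}" "y i \<in> {0, 1}" if "i < n" for i
    using assms that by (auto simp: cube_def dest: PiE_mem)
  then have "{i \<in> {..<n}. x i \<noteq> y i} = sdiff (support n x) (support n y)"
    by (fastforce simp: sdiff_def support_def)
  then show ?thesis by (simp add: hamming_def)
qed

lemma discrepancy_support:
  assumes "Z \<subseteq> cube n"
  shows "discrepancy n Z = (\<Sum>t\<le>n. \<Sum>x\<in>Pow {..<n}.
     ((\<Sum>z\<in>support n ` Z. if card (sdiff z x) \<le> t then 1 else 0) / real (card (support n ` Z))
       - ball_ft n t {} / 2 ^ n)\<^sup>2)"
proof -
  have inj: "inj_on (support n) (cube n)"
    using bij_betw_support bij_betw_imp_inj_on by blast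
  have card_Z: "card (support n ` Z) = card Z"
    using inj assms card_image inj_on_subset by blast
  have ball: "real (card (hball n x t)) = ball_ft n t {}" if x: "x \<in> cube n" for x t
  proof -
    have sx: "support n x \<subseteq> {..<n}" by (auto simp: support_def)
    have "finite (cube n)" using bij_betw_finite[OF bij_betw_support] by simp
    then have "real (card (hball n x t)) = (\<Sum>y\<in>cube n. if hamming n x y \<le> t then 1 else 0)"
      by (simp add: hball_def sum.If_cases Int_def)
    also have "\<dots> = (\<Sum>y\<in>cube n. if card (sdiff (support n x) (support n y)) \<le> t then 1 else 0)"
      using x by (intro sum.cong) (simp_all add: hamming_support)
    also have "\<dots> = (\<Sum>v\<in>Pow {..<n}. if card (sdiff (support n x) v) \<le> t then 1 else 0)"
      by (rule sum.reindex_bij_betw[OF bij_betw_support])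
    also have "\<dots> = (\<Sum>v\<in>Pow {..<n}. if card v \<le> t then 1 else 0)"
      by (rule sum_Pow_sdiff[OF sx])
    also have "\<dots> = ball_ft n t {}" by (simp add: ball_ft_def ft_def)
    finally show ?thesis .
  qed
  have count: "(\<Sum>z\<in>Z. indicator (hball n x t) z) = (\<Sum>z\<in>support n ` Z. if card (sdiff z (support n x)) \<le> t then 1 else (0 :: real))"
    if x: "x \<in> cube n" for x t
  proof -
    have "(\<Sum>z\<in>support n ` Z. if card (sdiff z (support n x)) \<le> t then 1 else (0 :: real))
        = (\<Sum>z\<in>Z. if card (sdiff (support n z) (support n x)) \<le> t then 1 else 0)"
      using inj_on_subset[OF inj assms] by (simp add: sum.reindex)
    also have "\<dots> = (\<Sum>z\<in>Z. indicator (hball n x t) z)"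
      using assms x by (intro sum.cong refl)
        (auto simp: indicator_def hball_def hamming_support sdiff_commute[of _ "support n x"])
    finally show ?thesis by simp
  qed
  have "discrepancy n Z = (\<Sum>t\<le>n. \<Sum>x\<in>cube n.
     ((\<Sum>z\<in>support n ` Z. if card (sdiff z (support n x)) \<le> t then 1 else 0) / real (card (support n ` Z))
       - ball_ft n t {} / 2 ^ n)\<^sup>2)"
    unfolding discrepancy_def atLeast0AtMost card_Z
    by (intro sum.cong refl) (simp add: count ball)
  also have "\<dots> = (\<Sum>t\<le>n. \<Sum>x\<in>Pow {..<n}.
     ((\<Sum>z\<in>support n ` Z. if card (sdiff z x) \<le> t then 1 else 0) / real (card (support n ` Z))
       - ball_ft n t {} / 2 ^ n)\<^sup>2)"
    by (intro sum.cong refl sum.reindex_bij_betw[OF bij_betw_support])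
  finally show ?thesis .
qed

text \<open>The ball count is the convolution of the code with the ball, and subtracting the mean
  removes exactly the frequency \<open>{}\<close>. Parseval then applies for each radius.\<close>

lemma discrepancy_energy:
  assumes Z: "Z \<subseteq> Pow {..<n}" "card Z > 0"
  shows "(\<Sum>t\<le>n. \<Sum>x\<in>Pow {..<n}.
     ((\<Sum>z\<in>Z. if card (sdiff z x) \<le> t then 1 else 0) / real (card Z) - ball_ft n t {} / 2 ^ n)\<^sup>2)
     = energy n Z (\<lambda>u. if u = {} then 0 else \<Sum>t\<le>n. (ball_ft n t u)\<^sup>2) / (2 ^ n * (real (card Z))\<^sup>2)"
proof -
  let ?N = "real (card Z)"
  define f where "f t x = (\<Sum>z\<in>Z. if card (sdiff z x) \<le> t then 1 else 0) / ?N - ball_ft n t {} / 2 ^ n" for t x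
  have ft_f: "ft n (f t) u = (if u = {} then 0 else (\<Sum>z\<in>Z. chi u z) * ball_ft n t u / ?N)"
    if u: "u \<subseteq> {..<n}" for t u
  proof -
    have fin: "finite u" using u finite_subset by blast
    have "(\<Sum>x\<in>Pow {..<n}. (\<Sum>z\<in>Z. if card (sdiff z x) \<le> t then 1 else 0) * chi u x)
        = (\<Sum>z\<in>Z. \<Sum>x\<in>Pow {..<n}. (if card (sdiff z x) \<le> t then 1 else 0) * chi u x)"
      unfolding sum_distrib_right by (rule sum.swap)
    also have "\<dots> = (\<Sum>z\<in>Z. chi u z * ball_ft n t u)"
    proof (rule sum.cong[OF refl])
      fix z assume "z \<in> Z"
      then have "z \<subseteq> {..<n}" using Z by auto
      then have "(\<Sum>x\<in>Pow {..<n}. (if card (sdiff z x) \<le> t then 1 else 0) * chi u x)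
          = (\<Sum>x\<in>Pow {..<n}. (if card x \<le> t then 1 else 0) * chi u (sdiff z x))"
        using sum_Pow_sdiff[of z "{..<n}" "\<lambda>x. (if card x \<le> t then 1 else 0) * chi u (sdiff z x)"] by simp
      also have "\<dots> = chi u z * ball_ft n t u"
        unfolding ball_ft_def ft_def sum_distrib_left
        by (intro sum.cong) (auto simp: chi_sdiff[OF fin])
      finally show "(\<Sum>x\<in>Pow {..<n}. (if card (sdiff z x) \<le> t then 1 else 0) * chi u x) = chi u z * ball_ft n t u" .
    qed
    finally have "(\<Sum>x\<in>Pow {..<n}. (\<Sum>z\<in>Z. if card (sdiff z x) \<le> t then 1 else 0) * chi u x)
        = (\<Sum>z\<in>Z. chi u z) * ball_ft n t u" by (simp add: sum_distrib_right)
    moreover have "ft n (f t) u = (\<Sum>x\<in>Pow {..<n}. (\<Sum>z\<in>Z. if card (sdiff z x) \<le> t then 1 else 0) * chi u x) / ?N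
        - ball_ft n t {} / 2 ^ n * (\<Sum>x\<in>Pow {..<n}. chi u x)"
      unfolding ft_def f_def left_diff_distrib sum_subtractf times_divide_eq_left
        sum_divide_distrib[symmetric] sum_distrib_left[symmetric] ..
    moreover have "(\<Sum>x\<in>Pow {..<n}. chi u x) = (if u = {} then 2 ^ n else 0)"
      using sum_chi[OF u] by (simp add: chi_commute[of u])
    ultimately show ?thesis using Z(2) by simp
  qed
  have "(\<Sum>x\<in>Pow {..<n}. (f t x)\<^sup>2)
      = (\<Sum>u\<in>Pow {..<n}. (\<Sum>z\<in>Z. chi u z)\<^sup>2 * (if u = {} then 0 else (ball_ft n t u)\<^sup>2)) / (2 ^ n * ?N\<^sup>2)" for t
  proof -
    have "2 ^ n * (\<Sum>x\<in>Pow {..<n}. (f t x)\<^sup>2) = (\<Sum>u\<in>Pow {..<n}. ft n (f t) u * ft n (f t) u)"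
      unfolding sum_ft_mult by (simp add: power2_eq_square)
    also have "\<dots> = (\<Sum>u\<in>Pow {..<n}. (\<Sum>z\<in>Z. chi u z)\<^sup>2 * (if u = {} then 0 else (ball_ft n t u)\<^sup>2) / ?N\<^sup>2)"
      by (intro sum.cong refl) (simp add: ft_f power2_eq_square)
    finally show ?thesis
      using Z(2) unfolding sum_divide_distrib[symmetric] by (simp add: field_simps)
  qed
  then have "(\<Sum>t\<le>n. \<Sum>x\<in>Pow {..<n}. (f t x)\<^sup>2)
      = (\<Sum>t\<le>n. energy n Z (\<lambda>u. if u = {} then 0 else (ball_ft n t u)\<^sup>2)) / (2 ^ n * ?N\<^sup>2)"
    by (simp add: energy_def sum_divide_distrib)
  also have "(\<Sum>t\<le>n. energy n Z (\<lambda>u. if u = {} then 0 else (ball_ft n t u)\<^sup>2))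
      = energy n Z (\<lambda>u. if u = {} then 0 else \<Sum>t\<le>n. (ball_ft n t u)\<^sup>2)"
    unfolding energy_sum[symmetric] by (intro arg_cong[of _ _ "energy n Z"] ext) simp
  finally show ?thesis unfolding f_def .
qed

lemma energy_singleton: "energy n {z} F = (\<Sum>u\<in>Pow {..<n}. F u)"
  by (simp add: energy_def power2_eq_square)

theorem theorem5p3:
  fixes n :: nat and Z :: "(nat \<Rightarrow> nat) set"
  assumes "perfect_code n Z"
  shows "discrepancy_minimizing n Z"
  unfolding discrepancy_minimizing_def
proof (intro allI impI)
  fix Z' assume Z': "Z' \<subseteq> cube n \<and> card Z' = card Z"
  obtain e where Z: "Z \<subseteq> cube n" and e: "\<forall>x\<in>cube n. \<exists>!z. z \<in> Z \<and> hamming n x z \<le> e"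
    using assms unfolding perfect_code_def by blast
  let ?S = "support n ` Z" and ?S' = "support n ` Z'"
  have inj: "inj_on (support n) (cube n)" and img: "support n ` cube n = Pow {..<n}"
    using bij_betw_support[of n] by (auto simp: bij_betw_def)
  have sub: "?S \<subseteq> Pow {..<n}" "?S' \<subseteq> Pow {..<n}"
    using image_mono[of _ "cube n" "support n"] Z Z' unfolding img by simp_all
  have card_eq: "card ?S' = card ?S"
    using Z Z' card_image[OF inj_on_subset[OF inj]] by simp
  have perfect: "\<exists>!z. z \<in> ?S \<and> card (sdiff x z) \<le> e" if x: "x \<subseteq> {..<n}" for x
  proof -
    obtain y where y: "y \<in> cube n" "x = support n y" using x img by blast
    then obtain w where w: "w \<in> Z" "hamming n y w \<le> e" "\<And>z. z \<in> Z \<Longrightarrow> hamming n y z \<le> e \<Longrightarrow> z = w"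
      using e by metis
    have ham: "hamming n y z = card (sdiff x (support n z))" if "z \<in> Z" for z
      using hamming_support[OF y(1), of z] Z that y(2) by blast
    show ?thesis
    proof (rule ex1I[of _ "support n w"])
      show "support n w \<in> ?S \<and> card (sdiff x (support n w)) \<le> e"
        using w(1,2) ham[OF w(1)] by simp
    next
      fix s assume "s \<in> ?S \<and> card (sdiff x s) \<le> e"
      then obtain z where "z \<in> Z" "s = support n z" "hamming n y z \<le> e" using ham by auto
      then show "s = support n w" using w(3) by blast
    qed
  qed
  have fin: "finite ?S" "finite ?S'" using sub finite_subset by blast+
  moreover have "?S \<noteq> {}" using perfect[of "{}"] by auto
  ultimately have pos: "card ?S > 0" by (simp add: card_gt_0_iff)
  have "energy n ?S (\<lambda>u. if u = {} then 0 else \<Sum>t\<le>n. (ball_ft n t u)\<^sup>2)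
      \<le> energy n ?S' (\<lambda>u. if u = {} then 0 else \<Sum>t\<le>n. (ball_ft n t u)\<^sup>2)"
  \<comment> \<open>A code with one word may have \<open>e\<close> too large for the locale; all
    codes with one word have the same energy.\<close>
  proof (cases "card ?S = 1")
    case True
    then obtain z z' where "?S = {z}" "?S' = {z'}"
      using card_eq by (metis card_1_singletonE)
    then show ?thesis by (simp add: energy_singleton)
  next
    case False
    then have "\<not> card ?S \<le> Suc 0" using pos by linarith
    then obtain z z' where z: "z \<in> ?S" "z' \<in> ?S" "z \<noteq> z'"
      using card_le_Suc0_iff_eq[OF fin(1)] by blast
    have "2 * e < card (sdiff z z')"
      by (rule perfect_separation[OF z sub(1) perfect])
    also have "\<dots> \<le> n"
      using card_mono[of "{..<n}" "sdiff z z'"] sdiff_subset[of z "{..<n}" z'] z sub(1) by auto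
    finally interpret binary_perfect_code n e ?S
      by unfold_locales (use sub perfect in auto)
    show ?thesis
      by (rule energy_ball_ft_square_le[OF sub(2) card_eq])
  qed
  then have "energy n ?S (\<lambda>u. if u = {} then 0 else \<Sum>t\<le>n. (ball_ft n t u)\<^sup>2) / (2 ^ n * (real (card ?S))\<^sup>2)
      \<le> energy n ?S' (\<lambda>u. if u = {} then 0 else \<Sum>t\<le>n. (ball_ft n t u)\<^sup>2) / (2 ^ n * (real (card ?S'))\<^sup>2)"
    unfolding card_eq by (rule divide_right_mono) simp
  moreover have "Z' \<subseteq> cube n" "card ?S' > 0" using Z' pos card_eq by simp_all
  ultimately show "discrepancy n Z \<le> discrepancy n Z'"
    using Z pos sub by (simp only: discrepancy_support discrepancy_energy)
qed

end
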